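(* Let $\Lambda(\varphi)=\xi_\tau(6+i\varphi)$ be the Ramanujan-Wilton function. Then for all $\varphi\in\mathbb{C}$, $$\Lambda(\varphi)=\Lambda(0)\prod_{\Re(\varphi_m)>0}\left(1-\frac{\varphi^2}{\varphi_m^2}\right),$$ where the product runs over all zeros $\varphi_m$ of $\Lambda$ with $\Re(\varphi_m)>0$.
   Context: The Ramanujan function $\tau(m)$ is defined by $q\prod_{n=1}^\infty(1-q^n)^{24}=\sum_{m=1}^\infty\tau(m)q^m$. The Ramanujan zeta function is $H_\tau(x)=\sum_{\ell=1}^\infty \tau(\ell)\ell^{-x}$ for $\Re(x)>13/2$, and $H_\tau$ also denotes its analytic continuation to $\mathbb{C}$. The Ramanujan-Rankin function $\xi_\tau(x)=(2\pi)^{-x}\Gamma(x)H_\tau(x)$ extends to an entire function of $x\in\mathbb{C}$ (denoted by the same symbol) satisfying $\xi_\tau(x)=\xi_\tau(12-x)$. In products over zeros, each zero is repeated according to its multiplicity. *)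

theory Defs
  imports
    "HOL-Complex_Analysis.Complex_Analysis"
    "HOL-Computational_Algebra.Formal_Power_Series"
begin

text \<open>The infinite product is taken in the (X-adic) metric topology on formal power series.\<close>

definition ramanujan_tau :: "nat \<Rightarrow> int" where
  "ramanujan_tau m = fps_nth (fps_X * (\<Prod>n. (1 - fps_X ^ Suc n) ^ 24)) m"

definition entire_continuation :: "(complex \<Rightarrow> complex) \<Rightarrow> complex set \<Rightarrow> complex \<Rightarrow> complex" where
  "entire_continuation f U = (THE g. g holomorphic_on UNIV \<and> (\<forall>z\<in>U. g z = f z))"

definition ramanujan_zeta :: "complex \<Rightarrow> complex" where
  "ramanujan_zeta =
     entire_continuation
       (\<lambda>x. \<Sum>l. of_int (ramanujan_tau (Suc l)) * of_nat (Suc l) powr (- x))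
       {x. Re x > 13/2}"

text \<open>
  \<^const>\<open>Gamma\<close> takes the junk value 0 at its poles, so the entire extension is
  obtained by removing the singularities there.
\<close>

definition ramanujan_xi :: "complex \<Rightarrow> complex" where
  "ramanujan_xi =
     remove_sings (\<lambda>x. of_real (2 * pi) powr (- x) * Gamma x * ramanujan_zeta x)"

definition ramanujan_Lambda :: "complex \<Rightarrow> complex" where
  "ramanujan_Lambda \<phi> = ramanujan_xi (6 + \<i> * \<phi>)"

text \<open>
  Unordered (unconditionally convergent) products over an arbitrary index set: the multiplicative
  analogue of \<^const>\<open>has_sum\<close>. As for \<^const>\<open>has_prod\<close>, finitely many
  factors may vanish, and the product of all but finitely many factors must have a nonzero limit.
\<close>

definition has_prod_on :: "('a \<Rightarrow> complex) \<Rightarrow> complex \<Rightarrow> 'a set \<Rightarrow> bool" where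
  "has_prod_on f p A \<longleftrightarrow>
     (\<exists>B q. finite B \<and> B \<subseteq> A \<and> q \<noteq> 0 \<and>
        (prod f \<longlongrightarrow> q) (finite_subsets_at_top (A - B)) \<and> p = prod f B * q)"

definition convergent_prod_on :: "('a \<Rightarrow> complex) \<Rightarrow> 'a set \<Rightarrow> bool" where
  "convergent_prod_on f A \<longleftrightarrow> (\<exists>p. has_prod_on f p A)"

definition infprod_on :: "('a \<Rightarrow> complex) \<Rightarrow> 'a set \<Rightarrow> complex" where
  "infprod_on f A = (THE p. has_prod_on f p A)"

text \<open>
  The pair \<open>(z, k)\<close> stands for the \<open>k\<close>-th copy of the zero \<open>z\<close>, so each zero is repeated
  according to its multiplicity.
\<close>

definition zeros_right_with_mult :: "(complex \<Rightarrow> complex) \<Rightarrow> (complex \<times> nat) set" where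
  "zeros_right_with_mult f = {(z, k). f z = 0 \<and> Re z > 0 \<and> int k < zorder f z}"

end

theory Submission
  imports Defs
begin

text \<open>
  Let \<open>\<Delta>(z) = q \<Prod>(1 - q\<^sup>n)\<^bsup>24\<^esup>\<close> with \<open>q = exp (2\<pi>iz)\<close>. The Mellin transform gives
  \<open>\<Lambda>(\<phi>) = \<integral> \<Delta>(i e\<^sup>u) e\<^bsup>6u\<^esup> cos(\<phi>u) du\<close> over the real line, because \<open>\<Delta>(i/y) = y\<^bsup>12\<^esup> \<Delta>(iy)\<close>. Hence
  \<open>\<Lambda>(\<phi>) = g(\<phi>\<^sup>2)\<close> for an entire function \<open>g\<close>, and the double exponential decay of the kernel bounds
  \<open>\<bar>g(w)\<bar>\<close> by \<open>A exp(2 \<bar>w\<bar>\<^bsup>3/4\<^esup>)\<close>. An entire function of order below 1 is the product of the factors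
  \<open>1 - w/w\<^sub>m\<close> over its zeros. The kernel is positive, so \<open>\<Lambda>\<close> has no zeros on the imaginary axis, and
  squaring maps the zeros of \<open>\<Lambda>\<close> with positive real part bijectively to the zeros of \<open>g\<close>.

  The inversion formula for \<open>\<Delta>\<close> follows by integrating that of the Eisenstein series of weight two.
  Absolute convergence of the Dirichlet series in the whole half plane \<open>Re x > 13/2\<close> comes from the mean
  square bound \<open>\<Sum>\<^bsub>n \<le> X\<^esub> \<tau>(n)\<^sup>2 = O(X\<^bsup>12\<^esup>)\<close>, that is, from Parseval on circles together with the
  boundedness of \<open>\<bar>\<Delta>(z)\<bar> (Im z)\<^sup>6\<close> on the upper half plane.
\<close>

section \<open>Unordered products\<close>

lemma filterlim_Diff_finite_subsets_at_top:
  assumes "B \<subseteq> A"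
  shows "filterlim (\<lambda>F. F - B) (finite_subsets_at_top (A - B)) (finite_subsets_at_top A)"
  unfolding filterlim_finite_subsets_at_top
proof (intro allI impI)
  fix X assume "finite X \<and> X \<subseteq> A - B"
  then show "\<forall>\<^sub>F F in finite_subsets_at_top A. finite (F - B) \<and> X \<subseteq> F - B \<and> F - B \<subseteq> A - B"
    unfolding eventually_finite_subsets_at_top by (intro exI[of _ X]) auto
qed

lemma has_prod_on_imp_tendsto:
  assumes "has_prod_on f p A"
  shows "(prod f \<longlongrightarrow> p) (finite_subsets_at_top A)"
proof -
  obtain B q where B: "finite B" "B \<subseteq> A" "(prod f \<longlongrightarrow> q) (finite_subsets_at_top (A - B))"
    and p: "p = prod f B * q"
    using assms unfolding has_prod_on_def by blast
  have "((\<lambda>F. prod f B * prod f (F - B)) \<longlongrightarrow> p) (finite_subsets_at_top A)"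
    unfolding p by (intro tendsto_mult tendsto_const filterlim_compose[OF B(3)]
        filterlim_Diff_finite_subsets_at_top B)
  moreover have "\<forall>\<^sub>F F in finite_subsets_at_top A. prod f B * prod f (F - B) = prod f F"
    unfolding eventually_finite_subsets_at_top
    using B by (intro exI[of _ B]) (metis prod.subset_diff mult.commute)
  ultimately show ?thesis
    using tendsto_cong by fast
qed

lemma infprod_on_eqI: "has_prod_on f p A \<Longrightarrow> infprod_on f A = p"
  unfolding infprod_on_def
  by (rule the_equality) (auto dest!: has_prod_on_imp_tendsto intro: tendsto_unique[rotated])

lemma has_prod_on_reindex:
  assumes bij: "bij_betw h A C" and f: "has_prod_on f p C"
  shows "has_prod_on (f \<circ> h) p A"
proof -
  obtain B q where B: "finite B" "B \<subseteq> C" "q \<noteq> 0" "(prod f \<longlongrightarrow> q) (finite_subsets_at_top (C - B))"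
    and p: "p = prod f B * q"
    using f unfolding has_prod_on_def by blast
  have inj: "inj_on h A" and img: "h ` A = C"
    using bij by (auto simp: bij_betw_def)
  define B' where "B' = A \<inter> h -` B"
  have hB: "h ` B' = B" "B' \<subseteq> A"
    using B img by (auto simp: B'_def)
  have injB: "inj_on h B'" and inj': "inj_on h (A - B')"
    using inj hB by (auto intro: inj_on_subset)
  have "h ` (A - B') = C - B"
    using hB img inj by (auto simp: B'_def)
  then have "filtermap ((`) h) (finite_subsets_at_top (A - B')) = finite_subsets_at_top (C - B)"
    using filtermap_image_finite_subsets_at_top[OF inj'] by simp
  then have "((\<lambda>F. prod f (h ` F)) \<longlongrightarrow> q) (finite_subsets_at_top (A - B'))"
    using B(4) unfolding filterlim_def by (metis filtermap_filtermap)
  moreover have "\<forall>\<^sub>F F in finite_subsets_at_top (A - B'). prod f (h ` F) = prod (f \<circ> h) F"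
    by (rule eventually_finite_subsets_at_top_weakI)
      (simp add: prod.reindex[OF inj_on_subset[OF inj]] subset_iff)
  ultimately have "(prod (f \<circ> h) \<longlongrightarrow> q) (finite_subsets_at_top (A - B'))"
    using tendsto_cong by fast
  moreover have "finite B'"
    using B(1) hB finite_image_iff[OF injB] by simp
  moreover have "prod f B = prod (f \<circ> h) B'"
    using prod.reindex[OF injB, of f] hB by simp
  ultimately show ?thesis
    unfolding has_prod_on_def using p B(3) hB(2) by (intro exI[of _ B'] exI[of _ q]) auto
qed

lemma finite_large_of_summable_on:
  fixes u :: "'a \<Rightarrow> real"
  assumes u: "u summable_on A" and pos: "\<And>x. x \<in> A \<Longrightarrow> 0 \<le> u x" and e: "e > 0"
  shows "finite {x\<in>A. e \<le> u x}"
proof (rule finite_if_finite_subsets_card_bdd[THEN conjunct1])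
  fix G assume G: "G \<subseteq> {x\<in>A. e \<le> u x}" "finite G"
  have "real (card G) * e = (\<Sum>x\<in>G. e)" by simp
  also have "\<dots> \<le> sum u G" using G by (intro sum_mono) auto
  also have "\<dots> \<le> infsum u A"
    using G pos u by (intro finite_sum_le_infsum) auto
  finally have "real (card G) \<le> infsum u A / e" using e by (simp add: field_simps)
  then show "card G \<le> nat \<lceil>infsum u A / e\<rceil>" by linarith
qed

lemma has_prod_on_one_minus_of_summable_on:
  fixes u :: "'a \<Rightarrow> complex"
  assumes "(\<lambda>i. norm (u i)) summable_on A"
  shows "\<exists>p. has_prod_on (\<lambda>i. 1 - u i) p A"
proof -
  define B where "B = {i\<in>A. 1/2 \<le> norm (u i)}"
  have B: "finite B" "B \<subseteq> A"
    using finite_large_of_summable_on[OF assms, of "1/2"] by (auto simp: B_def)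
  have "(\<lambda>i. 2 * norm (u i)) summable_on (A - B)"
    by (intro summable_on_cmult_right summable_on_subset_banach[OF assms]) auto
  then have "(\<lambda>i. norm (Ln (1 - u i))) summable_on (A - B)"
    by (rule Infinite_Sum.abs_summable_on_comparison_test') (use norm_Ln_le[of "- u _"] in \<open>auto simp: B_def\<close>)
  then obtain s where s: "((\<lambda>i. Ln (1 - u i)) has_sum s) (A - B)"
    using abs_summable_summable[of "\<lambda>i. Ln (1 - u i)"] by (auto simp: summable_on_def)
  have "((\<lambda>F. exp (\<Sum>i\<in>F. Ln (1 - u i))) \<longlongrightarrow> exp s) (finite_subsets_at_top (A - B))"
    using s unfolding has_sum_def by (intro tendsto_exp)
  moreover have "\<forall>\<^sub>F F in finite_subsets_at_top (A - B).
      exp (\<Sum>i\<in>F. Ln (1 - u i)) = (\<Prod>i\<in>F. 1 - u i)"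
  proof (rule eventually_finite_subsets_at_top_weakI)
    fix F assume F: "finite F" "F \<subseteq> A - B"
    then have "1 - u i \<noteq> 0" if "i \<in> F" for i
      using that by (auto simp: B_def)
    with F show "exp (\<Sum>i\<in>F. Ln (1 - u i)) = (\<Prod>i\<in>F. 1 - u i)"
      by (simp add: exp_sum)
  qed
  ultimately have "(prod (\<lambda>i. 1 - u i) \<longlongrightarrow> exp s) (finite_subsets_at_top (A - B))"
    using tendsto_cong by fast
  then have "has_prod_on (\<lambda>i. 1 - u i) (prod (\<lambda>i. 1 - u i) B * exp s) A"
    unfolding has_prod_on_def using B by (intro exI[of _ B] exI[of _ "exp s"]) auto
  then show ?thesis by blast
qed

lemma summable_on_powr_of_counting_bound:
  fixes w s :: "'a \<Rightarrow> real"
  assumes w: "\<And>x. x \<in> A \<Longrightarrow> 0 \<le> w x" and s: "\<And>x. x \<in> A \<Longrightarrow> 1 \<le> s x"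
    and bound: "\<And>X F. X \<ge> 1 \<Longrightarrow> finite F \<Longrightarrow> F \<subseteq> A \<Longrightarrow> (\<And>x. x \<in> F \<Longrightarrow> s x \<le> X) \<Longrightarrow>
      sum w F \<le> C * X powr \<alpha>"
    and "\<alpha> < \<beta>" "0 \<le> \<beta>"
  shows "(\<lambda>x. w x * s x powr (-\<beta>)) summable_on A"
proof (rule nonneg_bdd_above_summable_on)
  show "0 \<le> w x * s x powr (-\<beta>)" if "x \<in> A" for x
    using w[OF that] by simp
  have C: "0 \<le> C" using bound[of 1 "{}"] by simp
  define r where "r = 2 powr (\<alpha> - \<beta>)"
  have r: "0 < r" "r < 1"
    using \<open>\<alpha> < \<beta>\<close> powr_less_mono[of "\<alpha> - \<beta>" 0 2] by (auto simp: r_def)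
  have "(\<Sum>x\<in>F. w x * s x powr (-\<beta>)) \<le> C * 2 powr \<alpha> * (1 / (1 - r))"
    if F: "finite F" "F \<subseteq> A" for F
  proof -
    define j where "j = (\<lambda>x. nat \<lfloor>log 2 (s x)\<rfloor>)"
    have j: "2 powr real (j x) \<le> s x" "s x \<le> 2 powr real (Suc (j x))" if "x \<in> F" for x
    proof -
      have sx: "1 \<le> s x" using that F s by auto
      then have "0 \<le> log 2 (s x)" by simp
      then have "real (j x) \<le> log 2 (s x)" "log 2 (s x) \<le> real (Suc (j x))"
        by (auto simp: j_def) linarith+
      then have "2 powr real (j x) \<le> 2 powr log 2 (s x)" "2 powr log 2 (s x) \<le> 2 powr real (Suc (j x))"
        by (intro powr_mono; simp)+
      then show "2 powr real (j x) \<le> s x" "s x \<le> 2 powr real (Suc (j x))"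
        using sx by simp_all
    qed
    obtain N where N: "j ` F \<subseteq> {..<N}"
      using finite_nat_iff_bounded[THEN iffD1, OF finite_imageI[OF F(1)]] by blast
    have "(\<Sum>x\<in>F. w x * s x powr (-\<beta>)) = (\<Sum>i<N. \<Sum>x\<in>{x\<in>F. j x = i}. w x * s x powr (-\<beta>))"
      using F(1) N by (intro sum.group[symmetric]) auto
    also have "\<dots> \<le> (\<Sum>i<N. C * 2 powr \<alpha> * r ^ i)"
    proof (rule sum_mono)
      fix i
      have "(\<Sum>x\<in>{x\<in>F. j x = i}. w x * s x powr (-\<beta>)) \<le> (\<Sum>x\<in>{x\<in>F. j x = i}. w x * 2 powr (-\<beta> * i))"
      proof (rule sum_mono)
        fix x assume x: "x \<in> {x\<in>F. j x = i}"
        have "s x powr (-\<beta>) \<le> (2 powr real (j x)) powr (-\<beta>)"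
          using j(1)[of x] x \<open>0 \<le> \<beta>\<close> by (intro powr_mono2') auto
        also have "\<dots> = 2 powr (-\<beta> * i)"
          using x by (simp add: powr_powr mult.commute)
        finally show "w x * s x powr (-\<beta>) \<le> w x * 2 powr (-\<beta> * i)"
          using x F w by (intro mult_left_mono) auto
      qed
      also have "\<dots> = sum w {x\<in>F. j x = i} * 2 powr (-\<beta> * i)"
        by (simp add: sum_distrib_right)
      also have "\<dots> \<le> (C * (2 powr real (Suc i)) powr \<alpha>) * 2 powr (-\<beta> * i)"
      proof (intro mult_right_mono bound)
        show "1 \<le> 2 powr real (Suc i)" by (rule ge_one_powr_ge_zero) auto
      qed (use F j in auto)
      also have "\<dots> = C * 2 powr \<alpha> * r ^ i"
      proof -
        have "r ^ i = 2 powr ((\<alpha> - \<beta>) * i)"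
          by (simp add: r_def powr_power mult.commute)
        then show ?thesis
          by (simp add: powr_powr powr_add[symmetric] mult.assoc) (simp add: algebra_simps)
      qed
      finally show "(\<Sum>x\<in>{x\<in>F. j x = i}. w x * s x powr (-\<beta>)) \<le> C * 2 powr \<alpha> * r ^ i" .
    qed
    also have "\<dots> = C * 2 powr \<alpha> * (\<Sum>i<N. r ^ i)"
      by (simp add: sum_distrib_left)
    also have "\<dots> \<le> C * 2 powr \<alpha> * (1 / (1 - r))"
    proof (intro mult_left_mono)
      have "(\<Sum>i<N. r ^ i) \<le> (\<Sum>i. r ^ i)"
        using r by (intro sum_le_suminf summable_geometric) auto
      then show "(\<Sum>i<N. r ^ i) \<le> 1 / (1 - r)"
        using r by (simp add: suminf_geometric)
    qed (use C in auto)
    finally show ?thesis .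
  qed
  then show "bdd_above (sum (\<lambda>x. w x * s x powr (-\<beta>)) ` {F. F \<subseteq> A \<and> finite F})"
    by (intro bdd_aboveI) auto
qed

section \<open>Hadamard factorization in genus zero\<close>

lemma entire_factor_zero:
  assumes f: "f holomorphic_on UNIV" and nz: "f b \<noteq> 0"
  obtains h n where "h holomorphic_on UNIV" "h a \<noteq> 0" "\<And>w. f w = h w * (w - a) ^ n"
proof -
  define n where "n = nat (zorder f a)"
  have "\<exists>w\<in>UNIV. f w \<noteq> 0" using nz by auto
  from zorder_exist_zero[OF f open_UNIV connected_UNIV UNIV_I this, of a]
  obtain r where r: "r > 0" "zor_poly f a holomorphic_on cball a r"
    and eq: "\<And>w. w \<in> cball a r \<Longrightarrow> f w = zor_poly f a w * (w - a) ^ n \<and> zor_poly f a w \<noteq> 0"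
    unfolding n_def by blast
  define h where "h = (\<lambda>w. if w = a then zor_poly f a a else f w / (w - a) ^ n)"
  have h_eq: "h w = zor_poly f a w" if "w \<in> ball a r" for w
    using eq[of w] that by (auto simp: h_def)
  have "zor_poly f a holomorphic_on ball a r"
    using r(2) by (rule holomorphic_on_subset) auto
  then have "h holomorphic_on ball a r"
    by (rule holomorphic_transform) (simp add: h_eq)
  moreover have "(\<lambda>w. f w / (w - a) ^ n) holomorphic_on - {a}"
    by (intro holomorphic_intros holomorphic_on_subset[OF f]) auto
  then have "h holomorphic_on - {a}"
    by (rule holomorphic_transform) (auto simp: h_def)
  ultimately have "h holomorphic_on ball a r \<union> - {a}"
    by (intro holomorphic_on_Un) auto
  moreover have "ball a r \<union> - {a} = UNIV"
    using r(1) by auto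
  moreover have "h a \<noteq> 0"
    using eq[of a] r(1) by (simp add: h_def)
  moreover have "f w = h w * (w - a) ^ n" for w
    using eq[of a] r(1) by (cases "w = a") (auto simp: h_def)
  ultimately show ?thesis
    using that[of h n] by simp
qed

lemma entire_factor_finite_zeros:
  assumes f: "f holomorphic_on UNIV" and nz: "f b \<noteq> 0" and S: "finite S"
  shows "\<exists>h. h holomorphic_on UNIV \<and> (\<forall>z\<in>S. h z \<noteq> 0) \<and>
    (\<forall>w. f w = h w * (\<Prod>z\<in>S. (w - z) ^ nat (zorder f z)))"
proof -
  have "\<exists>h n. h holomorphic_on UNIV \<and> (\<forall>z\<in>S. h z \<noteq> 0) \<and>
      (\<forall>w. f w = h w * (\<Prod>z\<in>S. (w - z) ^ n z))"
    using S
  proof induction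
    case empty
    then show ?case using f by auto
  next
    case (insert a S)
    then obtain h n where h: "h holomorphic_on UNIV" "\<forall>z\<in>S. h z \<noteq> 0"
      "\<And>w. f w = h w * (\<Prod>z\<in>S. (w - z) ^ n z)" by blast
    have "h b \<noteq> 0" using h(3)[of b] nz by auto
    then obtain k m where k: "k holomorphic_on UNIV" "k a \<noteq> 0" "\<And>w. h w = k w * (w - a) ^ m"
      by (rule entire_factor_zero[OF h(1)]) blast
    have "(\<Prod>z\<in>S. (w - z) ^ (n(a := m)) z) = (\<Prod>z\<in>S. (w - z) ^ n z)" for w
      using insert.hyps by (intro prod.cong) auto
    then have "f w = k w * (\<Prod>z\<in>insert a S. (w - z) ^ (n(a := m)) z)" for w
      using insert.hyps h(3)[of w] k(3)[of w] by simp
    moreover have "\<forall>z\<in>insert a S. k z \<noteq> 0"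
      using k h(2) by auto
    ultimately show ?case using k(1) by blast
  qed
  then obtain h n where h: "h holomorphic_on UNIV" "\<forall>z\<in>S. h z \<noteq> 0"
      "\<And>w. f w = h w * (\<Prod>z\<in>S. (w - z) ^ n z)" by blast
  have "zorder f z = int (n z)" if z: "z \<in> S" for z
  proof (rule zorder_eqI)
    show "(\<lambda>w. h w * (\<Prod>x\<in>S-{z}. (w - x) ^ n x)) holomorphic_on UNIV"
      by (intro holomorphic_intros h)
    show "h z * (\<Prod>x\<in>S-{z}. (z - x) ^ n x) \<noteq> 0"
      using h(2) z S by auto
    show "f w = h w * (\<Prod>x\<in>S-{z}. (w - x) ^ n x) * (w - z) powi int (n z)" for w
      using h(3)[of w] z S by (simp add: prod.remove[of S z])
  qed auto
  then show ?thesis using h by (intro exI[of _ h]) simp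
qed

lemma Borel_Caratheodory_zero:
  fixes L :: "complex \<Rightarrow> complex"
  assumes L: "L holomorphic_on ball 0 R" "L 0 = 0" and K: "\<And>w. norm w < R \<Longrightarrow> Re (L w) < K"
    and w: "norm w < R"
  shows "norm (L w) \<le> 2 * K * norm w / (R - norm w)"
proof -
  have R: "R > 0" using w norm_ge_zero[of w] by linarith
  have K0: "K > 0" using K[of 0] L(2) R by simp
  define \<phi> where "\<phi> = (\<lambda>z::complex. L (R * z) / (2 * K - L (R * z)))"
  have in_ball: "norm (R * z) < R" if "norm z < 1" for z :: complex
    using that R by (simp add: norm_mult)
  have nz: "2 * K - L (R * z) \<noteq> 0" if "norm z < 1" for z :: complex
    using K[OF in_ball[OF that]] K0 by (auto simp: complex_eq_iff)
  have "(L \<circ> (\<lambda>z. R * z)) holomorphic_on ball 0 1"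
    by (rule holomorphic_on_compose_gen[OF _ L(1)])
      (use R in \<open>auto intro!: holomorphic_intros simp: norm_mult\<close>)
  then have hol: "\<phi> holomorphic_on ball 0 1"
    unfolding \<phi>_def o_def using nz by (intro holomorphic_intros) auto
  have \<phi>0: "\<phi> 0 = 0" using L(2) by (simp add: \<phi>_def)
  have lt: "norm (\<phi> z) < 1" if "norm z < 1" for z
  proof -
    have re: "Re (L (R * z)) < K" by (rule K[OF in_ball[OF that]])
    have "(norm (L (R * z)))\<^sup>2 < (norm (2 * K - L (R * z)))\<^sup>2"
    proof -
      have "(norm (2 * K - L (R * z)))\<^sup>2 - (norm (L (R * z)))\<^sup>2 = 4 * K * (K - Re (L (R * z)))"
        unfolding cmod_power2 by (simp add: power2_eq_square algebra_simps)
      also have "\<dots> > 0" using re K0 by simp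
      finally show ?thesis by simp
    qed
    then have "norm (L (R * z)) < norm (2 * K - L (R * z))"
      by (rule power2_less_imp_less) simp
    then show ?thesis
      using nz[OF that] by (simp add: \<phi>_def norm_divide)
  qed
  define z where "z = w / R"
  have z: "norm z < 1" "R * z = w" using w R by (auto simp: z_def norm_divide)
  have "norm (\<phi> z) \<le> norm z"
    using Schwarz_Lemma(1)[OF hol \<phi>0 lt z(1)] .
  moreover have "L w = \<phi> z * (2 * K - L w)"
    using nz[OF z(1)] z(2) by (simp add: \<phi>_def)
  then have "norm (L w) = norm (\<phi> z) * norm (2 * K - L w)"
    by (metis norm_mult)
  moreover have "norm (2 * K - L w) \<le> 2 * K + norm (L w)"
    using norm_triangle_ineq4[of "2 * complex_of_real K" "L w"] K0 by (simp add: norm_mult)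
  ultimately have "norm (L w) \<le> norm z * (2 * K + norm (L w))"
    using mult_mono[of "norm (\<phi> z)" "norm z" "norm (2 * K - L w)" "2 * K + norm (L w)"] by simp
  moreover have "norm z = norm w / R" using R by (simp add: z_def norm_divide)
  ultimately have "norm (L w) * R \<le> norm w * (2 * K + norm (L w))"
    using R by (simp add: field_simps)
  then show ?thesis using w by (simp add: field_simps)
qed

locale genus_zero =
  fixes g :: "complex \<Rightarrow> complex" and A B \<rho> :: real
  assumes hol: "g holomorphic_on UNIV" and g0: "g 0 \<noteq> 0"
    and growth: "\<And>w. norm (g w) \<le> A * exp (B * norm w powr \<rho>)"
    and \<rho>: "0 < \<rho>" "\<rho> < 1" and B: "0 \<le> B"
begin

definition zero_index where "zero_index = {(z, k::nat). g z = 0 \<and> int k < zorder g z}"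

definition zeros_upto where "zeros_upto R = {z. g z = 0 \<and> norm z \<le> R}"

definition zero_index_upto where "zero_index_upto R = {(z, k). (z, k) \<in> zero_index \<and> norm z \<le> R}"

lemma A_pos: "A > 0"
proof -
  have "0 < norm (g 0)" using g0 by simp
  also have "\<dots> \<le> A" using growth[of 0] \<rho> by simp
  finally show ?thesis .
qed

lemma finite_zeros_upto: "finite (zeros_upto R)"
proof (cases "g constant_on UNIV")
  case True
  then have "g z \<noteq> 0" for z using g0 by (metis UNIV_I constant_on_def)
  then show ?thesis by (simp add: zeros_upto_def)
next
  case False
  have "finite {z\<in>cball 0 R. g z = 0}"
    by (rule holomorphic_compact_finite_zeros[OF hol]) (use False in auto)
  then show ?thesis by (rule finite_subset[rotated]) (auto simp: zeros_upto_def)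
qed

lemma zero_index_upto_eq: "zero_index_upto R = (SIGMA z:zeros_upto R. {..<nat (zorder g z)})"
  by (auto simp: zero_index_upto_def zero_index_def zeros_upto_def)

lemma finite_zero_index_upto: "finite (zero_index_upto R)"
  unfolding zero_index_upto_eq by (intro finite_SigmaI finite_zeros_upto) auto

definition log_growth where "log_growth R = ln (A / norm (g 0)) + B * (4 * R) powr \<rho>"

text \<open>
  Dividing out the zeros in the disc of radius \<open>R\<close> costs nothing in growth: on the circle of radius
  \<open>4R\<close> every factor has modulus at least 3. Evaluating at 0 then bounds the number of zeros, and the
  Borel--Caratheodory inequality shows that the zero-free quotients \<open>H\<close> tend to the constant \<open>g 0\<close>.
\<close>

lemma disc_factor:
  assumes R: "R > 0"
  obtains H where "H holomorphic_on UNIV" "H 0 = g 0" "\<And>w. norm w \<le> R \<Longrightarrow> H w \<noteq> 0"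
    "\<And>w. g w = H w * (\<Prod>(z, k)\<in>zero_index_upto R. 1 - w / z)"
    "\<And>w. norm w \<le> 4 * R \<Longrightarrow> norm (H w) \<le> norm (g 0) * exp (log_growth R) / 3 ^ card (zero_index_upto R)"
proof -
  define m where "m = (\<lambda>z. nat (zorder g z))"
  obtain h where h: "h holomorphic_on UNIV" "\<forall>z\<in>zeros_upto R. h z \<noteq> 0"
    "\<And>w. g w = h w * (\<Prod>z\<in>zeros_upto R. (w - z) ^ m z)"
    using entire_factor_finite_zeros[OF hol g0 finite_zeros_upto, of R] unfolding m_def by blast
  have Znz: "z \<noteq> 0" if "z \<in> zeros_upto R" for z using that g0 by (auto simp: zeros_upto_def)
  define H where "H = (\<lambda>w. h w * (\<Prod>z\<in>zeros_upto R. (- z) ^ m z))"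
  have prod_eq: "(\<Prod>(z, k)\<in>zero_index_upto R. F z) = (\<Prod>z\<in>zeros_upto R. F z ^ m z)" for F :: "complex \<Rightarrow> complex"
    unfolding zero_index_upto_eq m_def
    by (subst prod.Sigma[symmetric]) (auto simp: finite_zeros_upto)
  have g_eq: "g w = H w * (\<Prod>(z, k)\<in>zero_index_upto R. 1 - w / z)" for w
  proof -
    have "(\<Prod>z\<in>zeros_upto R. (w - z) ^ m z) = (\<Prod>z\<in>zeros_upto R. (- z) ^ m z * (1 - w / z) ^ m z)"
    proof (rule prod.cong)
      fix z assume "z \<in> zeros_upto R"
      then have "w - z = - z * (1 - w / z)" using Znz by (simp add: field_simps)
      then show "(w - z) ^ m z = (- z) ^ m z * (1 - w / z) ^ m z"
        by (metis power_mult_distrib)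
    qed auto
    then show ?thesis
      by (simp add: H_def h(3)[of w] prod_eq prod.distrib)
  qed
  have H_hol: "H holomorphic_on UNIV"
    unfolding H_def by (intro holomorphic_intros h)
  have H0: "H 0 = g 0"
    using g_eq[of 0] by (simp add: case_prod_unfold)
  have H_nz: "H w \<noteq> 0" if "norm w \<le> R" for w
  proof (cases "w \<in> zeros_upto R")
    case True
    then have "h w \<noteq> 0" "(\<Prod>z\<in>zeros_upto R. (- z) ^ m z) \<noteq> 0"
      using h(2) Znz finite_zeros_upto by (blast, simp)
    then show ?thesis by (simp add: H_def)
  next
    case False
    then have "g w \<noteq> 0" using that by (auto simp: zeros_upto_def)
    then show ?thesis using g_eq[of w] by (metis mult_zero_left)
  qed
  define Q where "Q = norm (g 0) * exp (log_growth R) / 3 ^ card (zero_index_upto R)"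
  have "norm (H w) \<le> Q" if w: "norm w = 4 * R" for w
  proof -
    have "3 \<le> norm (1 - w / z)" if "z \<in> zeros_upto R" for z
    proof -
      have z: "0 < norm z" "norm z \<le> R" using that Znz[OF that] by (auto simp: zeros_upto_def)
      have "4 \<le> norm (w / z)" using z R w by (simp add: norm_divide field_simps)
      then show ?thesis using norm_triangle_ineq2[of "w / z" 1]
        by (simp add: norm_minus_commute)
    qed
    then have "(\<Prod>p\<in>zero_index_upto R. 3) \<le> (\<Prod>p\<in>zero_index_upto R. norm (1 - w / fst p))"
      by (intro prod_mono) (auto simp: zero_index_upto_eq)
    then have "3 ^ card (zero_index_upto R) \<le> norm (\<Prod>(z, k)\<in>zero_index_upto R. 1 - w / z)"
      by (simp add: prod_norm case_prod_unfold)
    then have "norm (H w) * 3 ^ card (zero_index_upto R) \<le> norm (g w)"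
      unfolding g_eq[of w] norm_mult by (intro mult_left_mono) auto
    also have "norm (g w) \<le> norm (g 0) * exp (log_growth R)"
      using growth[of w] A_pos g0 by (simp add: log_growth_def w exp_add)
    finally show ?thesis by (simp add: Q_def field_simps)
  qed
  then have bd: "norm (H w) \<le> Q" if "w \<in> frontier (cball 0 (4 * R))" for w
    using R that by simp
  have Q: "norm (H w) \<le> Q" if "norm w \<le> 4 * R" for w
  proof (rule maximum_modulus_frontier[where f = H and \<xi> = w and S = "cball 0 (4 * R)"])
    show "continuous_on (closure (cball 0 (4 * R))) H"
      using holomorphic_on_imp_continuous_on[OF H_hol] continuous_on_subset by blast
    show "w \<in> cball 0 (4 * R)" using that by simp
  qed (use bd holomorphic_on_subset[OF H_hol] in auto)
  show ?thesis
    by (rule that[OF H_hol H0 H_nz g_eq Q[unfolded Q_def]])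
qed

lemma card_zero_index_upto_le: "R > 0 \<Longrightarrow> real (card (zero_index_upto R)) \<le> log_growth R"
proof -
  assume R: "R > 0"
  obtain H where H: "H 0 = g 0"
    "\<And>w::complex. norm w \<le> 4 * R \<Longrightarrow> norm (H w) \<le> norm (g 0) * exp (log_growth R) / 3 ^ card (zero_index_upto R)"
    by (rule disc_factor[OF R]) blast
  from H(2)[of 0] H(1) R have "norm (g 0) \<le> norm (g 0) * exp (log_growth R) / 3 ^ card (zero_index_upto R)"
    by simp
  then have "3 ^ card (zero_index_upto R) \<le> exp (log_growth R)"
    using g0 by (simp add: field_simps)
  moreover have "exp (real (card (zero_index_upto R))) \<le> 3 ^ card (zero_index_upto R)"
    using exp_le by (simp add: exp_of_nat_mult[of _ 1, simplified] power_mono)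
  ultimately show ?thesis
    by (metis exp_le_cancel_iff order_trans)
qed

lemma log_growth_bound:
  obtains C where "\<And>R. R \<ge> 1 \<Longrightarrow> log_growth R \<le> C * R powr \<rho>"
proof
  fix R :: real assume R: "R \<ge> 1"
  have "\<bar>ln (A / norm (g 0))\<bar> * 1 \<le> \<bar>ln (A / norm (g 0))\<bar> * R powr \<rho>"
    using R \<rho> by (intro mult_left_mono ge_one_powr_ge_zero) auto
  then have "ln (A / norm (g 0)) \<le> \<bar>ln (A / norm (g 0))\<bar> * R powr \<rho>"
    by linarith
  then show "log_growth R \<le> (\<bar>ln (A / norm (g 0))\<bar> + B * 4 powr \<rho>) * R powr \<rho>"
    using R by (simp add: log_growth_def powr_mult algebra_simps)
qed

lemma summable_inverse_zeros: "(\<lambda>(z, k). 1 / norm z) summable_on zero_index"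
proof -
  obtain C where C: "\<And>R. R \<ge> 1 \<Longrightarrow> log_growth R \<le> C * R powr \<rho>" using log_growth_bound by blast
  have "(\<lambda>p. 1 * (1 + norm (fst p)) powr (-1)) summable_on zero_index"
  proof (rule summable_on_powr_of_counting_bound)
    show "(\<Sum>p\<in>F. 1) \<le> C * X powr \<rho>"
      if "X \<ge> 1" "finite F" "F \<subseteq> zero_index" "\<And>p. p \<in> F \<Longrightarrow> 1 + norm (fst p) \<le> X" for X F
    proof -
      have "F \<subseteq> zero_index_upto X" using that by (fastforce simp: zero_index_upto_def)
      then have "real (card F) \<le> real (card (zero_index_upto X))"
        using finite_zero_index_upto by (simp add: card_mono)
      also have "\<dots> \<le> log_growth X" using that by (intro card_zero_index_upto_le) auto
      also have "\<dots> \<le> C * X powr \<rho>" using C that by auto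
      finally show ?thesis by simp
    qed
  qed (use \<rho> in auto)
  then have sum1: "(\<lambda>p. 1 / (1 + norm (fst p))) summable_on zero_index"
    by (simp add: powr_minus_divide)
  have "isCont g 0"
    using holomorphic_on_imp_continuous_on[OF hol] by (simp add: continuous_on_eq_continuous_at)
  then have "\<forall>\<^sub>F z in at 0. g z \<noteq> 0"
    using g0 by (intro tendsto_imp_eventually_ne[where c = "g 0"]) (simp_all add: isCont_def)
  then obtain d where d: "d > 0" "\<And>z. z \<noteq> 0 \<Longrightarrow> norm z < d \<Longrightarrow> g z \<noteq> 0"
    by (auto simp: eventually_at)
  have "(\<lambda>p. (1 + 1 / d) * (1 / (1 + norm (fst p)))) summable_on zero_index"
    using sum1 by (rule summable_on_cmult_right)
  then have "(\<lambda>p. 1 / norm (fst p)) summable_on zero_index"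
  proof (rule summable_on_comparison_test)
    fix p assume "p \<in> zero_index"
    then have "g (fst p) = 0" by (auto simp: zero_index_def)
    then have "fst p \<noteq> 0" "\<not> norm (fst p) < d"
      using g0 d(2)[of "fst p"] by metis+
    then have "d \<le> norm (fst p)" by simp
    then show "1 / norm (fst p) \<le> (1 + 1 / d) * (1 / (1 + norm (fst p)))"
      using d(1) by (simp add: divide_simps) (simp add: algebra_simps)
  qed auto
  then show ?thesis by (simp add: case_prod_unfold)
qed

lemma partial_products_tendsto:
  "(\<lambda>n. \<Prod>(z, k)\<in>zero_index_upto (real n). 1 - w / z) \<longlonglongrightarrow> g w / g 0"
proof -
  obtain C where C: "\<And>R. R \<ge> 1 \<Longrightarrow> log_growth R \<le> C * R powr \<rho>" using log_growth_bound by blast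
  define E where "E = (\<lambda>n::nat. 2 * (C * n powr \<rho> + 1) * norm w / (n - norm w))"
  have E0: "E \<longlonglongrightarrow> 0"
    unfolding E_def using \<rho> by real_asymp
  have "\<exists>L. norm L \<le> E n \<and> (\<Prod>(z, k)\<in>zero_index_upto (real n). 1 - w / z) = g w / g 0 * exp (- L)"
    if n: "real n > norm w" "n \<ge> 1" for n
  proof -
    have R: "real n > 0" using n by simp
    obtain H where H: "H holomorphic_on UNIV" "H 0 = g 0" "\<And>w. norm w \<le> n \<Longrightarrow> H w \<noteq> 0"
      "\<And>w. g w = H w * (\<Prod>(z, k)\<in>zero_index_upto (real n). 1 - w / z)"
      "\<And>w. norm w \<le> 4 * real n \<Longrightarrow> norm (H w) \<le> norm (g 0) * exp (log_growth n) / 3 ^ card (zero_index_upto n)"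
      by (rule disc_factor[OF R]) blast
    obtain L where L: "L holomorphic_on ball 0 n" "\<And>x. x \<in> ball 0 n \<Longrightarrow> exp (L x) = H x / g 0"
    proof (rule holomorphic_logarithm_exists[of "ball 0 (real n)" "\<lambda>x. H x / g 0" 0])
      show "(\<lambda>x. H x / g 0) holomorphic_on ball 0 (real n)"
        using g0 by (intro holomorphic_intros holomorphic_on_subset[OF H(1)]) auto
    qed (use H(3) g0 R in auto)
    define L' where "L' = (\<lambda>x. L x - L 0)"
    have "exp (L 0) = 1" using L(2)[of 0] H(2) g0 R by simp
    then have expL': "exp (L' x) = H x / g 0" if "norm x < n" for x
      using L(2)[of x] that by (simp add: L'_def exp_diff)
    have "norm (L' w) \<le> 2 * (log_growth n + 1) * norm w / (n - norm w)"
    proof (rule Borel_Caratheodory_zero)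
      show "L' holomorphic_on ball 0 (real n)"
        unfolding L'_def by (intro holomorphic_intros L)
      fix x :: complex assume x: "norm x < n"
      have "exp (Re (L' x)) = norm (H x) / norm (g 0)"
        using expL'[OF x] by (metis norm_exp_eq_Re norm_divide)
      also have "\<dots> \<le> exp (log_growth n) / 3 ^ card (zero_index_upto n)"
        using H(5)[of x] x g0 by (simp add: field_simps)
      also have "\<dots> \<le> exp (log_growth n)"
        by (simp add: divide_le_eq)
      finally show "Re (L' x) < log_growth n + 1" by simp
    qed (use n in \<open>auto simp: L'_def\<close>)
    also have "\<dots> \<le> E n"
      unfolding E_def using C[of n] n by (intro divide_right_mono mult_right_mono mult_left_mono) auto
    finally have "norm (L' w) \<le> E n" .
    moreover have "(\<Prod>(z, k)\<in>zero_index_upto (real n). 1 - w / z) = g w / g 0 * exp (- L' w)"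
      using H(4)[of w] H(3)[of w] expL'[of w] n g0 by (simp add: exp_minus field_simps)
    ultimately show ?thesis by blast
  qed
  then obtain L where L: "\<And>n. real n > norm w \<Longrightarrow> n \<ge> 1 \<Longrightarrow> norm (L n) \<le> E n \<and>
      (\<Prod>(z, k)\<in>zero_index_upto (real n). 1 - w / z) = g w / g 0 * exp (- L n)"
    by metis
  have ev: "\<forall>\<^sub>F n in sequentially. real n > norm w \<and> n \<ge> 1"
    by (intro eventually_conj eventually_ge_at_top)
      (use eventually_gt_at_top[of "nat \<lceil>norm w\<rceil>"] in \<open>eventually_elim, linarith\<close>)
  have "L \<longlonglongrightarrow> 0"
    by (rule Lim_null_comparison[OF _ E0]) (use ev in eventually_elim, use L in blast)
  then have "(\<lambda>n. g w / g 0 * exp (- L n)) \<longlonglongrightarrow> g w / g 0 * exp (- 0)"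
    by (intro tendsto_intros)
  moreover have "\<forall>\<^sub>F n in sequentially. g w / g 0 * exp (- L n) = (\<Prod>(z, k)\<in>zero_index_upto (real n). 1 - w / z)"
    using ev by eventually_elim (use L in auto)
  ultimately show ?thesis
    by (simp add: tendsto_cong)
qed

theorem has_prod_on_zeros: "has_prod_on (\<lambda>(z, k). 1 - w / z) (g w / g 0) zero_index"
proof -
  have "(\<lambda>p. norm w * (1 / norm (fst p))) summable_on zero_index"
    using summable_inverse_zeros by (intro summable_on_cmult_right) (simp add: case_prod_unfold)
  then have "(\<lambda>p. norm (w / fst p)) summable_on zero_index"
    by (simp add: norm_divide)
  from has_prod_on_one_minus_of_summable_on[OF this]
  obtain p where p: "has_prod_on (\<lambda>(z, k). 1 - w / z) p zero_index"
    by (auto simp: case_prod_unfold)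
  have "filterlim (\<lambda>n. zero_index_upto (real n)) (finite_subsets_at_top zero_index) sequentially"
    unfolding filterlim_finite_subsets_at_top
  proof (intro allI impI)
    fix X assume X: "finite X \<and> X \<subseteq> zero_index"
    define N where "N = (\<Sum>p\<in>X. norm (fst p))"
    have "norm (fst p) \<le> N" if "p \<in> X" for p
      unfolding N_def using X that by (intro member_le_sum) auto
    then have "X \<subseteq> zero_index_upto (real n)" if "real n \<ge> N" for n
      using that X by (fastforce simp: zero_index_upto_def)
    moreover have "\<forall>\<^sub>F n in sequentially. real n \<ge> N"
      using eventually_ge_at_top[of "nat \<lceil>N\<rceil>"] by eventually_elim linarith
    ultimately show "\<forall>\<^sub>F n in sequentially. finite (zero_index_upto (real n)) \<and> X \<subseteq> zero_index_upto (real n) \<and> zero_index_upto (real n) \<subseteq> zero_index"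
      using finite_zero_index_upto by (auto elim!: eventually_mono simp: zero_index_upto_def)
  qed
  from filterlim_compose[OF has_prod_on_imp_tendsto[OF p] this]
  have "p = g w / g 0"
    using partial_products_tendsto LIMSEQ_unique by blast
  then show ?thesis using p by simp
qed

end

section \<open>The Euler product\<close>

definition euler_prod :: "complex \<Rightarrow> complex" where
  "euler_prod q = (\<Prod>n. 1 - q ^ Suc n)"

lemma abs_convergent_euler_prod:
  fixes q :: complex
  assumes "norm q < 1"
  shows "abs_convergent_prod (\<lambda>n. 1 - q ^ Suc n)"
proof -
  have "summable (\<lambda>n. norm q * norm q ^ n)"
    using assms by (intro summable_mult summable_geometric) auto
  then show ?thesis
    by (simp add: abs_convergent_prod_conv_summable norm_mult norm_power)
qed

lemma euler_prod_LIMSEQ: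
  assumes "norm q < 1"
  shows "(\<lambda>N. \<Prod>n<N. 1 - q ^ Suc n) \<longlonglongrightarrow> euler_prod q"
  unfolding euler_prod_def
  by (intro has_prod_imp_tendsto' convergent_prod_has_prod
      abs_convergent_prod_imp_convergent_prod abs_convergent_euler_prod assms)

lemma euler_prod_nonzero: "norm q < 1 \<Longrightarrow> euler_prod q \<noteq> 0"
  unfolding euler_prod_def
proof (rule prodinf_nonzero)
  assume q: "norm q < 1"
  then show "convergent_prod (\<lambda>n. 1 - q ^ Suc n)"
    by (intro abs_convergent_prod_imp_convergent_prod abs_convergent_euler_prod)
  fix n
  have "norm (q ^ Suc n) < 1" using power_Suc_less_one[of "norm q" n] q by (cases "q = 0") (auto simp: norm_power simp del: power_Suc)
  then show "1 - q ^ Suc n \<noteq> 0" by auto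
qed

lemma uniform_limit_euler_prod:
  assumes r: "r < 1"
  shows "uniform_limit (cball 0 r) (\<lambda>N q. \<Prod>n<N. 1 - q ^ Suc n) euler_prod sequentially"
proof -
  have "uniformly_convergent_on (cball 0 r) (\<lambda>N q. \<Prod>n<N. 1 - q ^ Suc n :: complex)"
  proof (rule uniformly_convergent_on_prod')
    show "uniformly_convergent_on (cball 0 r) (\<lambda>N q. \<Sum>n<N. norm (1 - q ^ Suc n - 1 :: complex))"
    proof (cases "r \<ge> 0")
      case True
      then have "summable (\<lambda>n. r ^ Suc n)"
        using r by (subst summable_Suc_iff) (auto intro: summable_geometric)
      then show ?thesis
        by (rule Weierstrass_m_test'_ev[rotated])
          (use True in \<open>auto simp: norm_mult norm_power intro!: always_eventually mult_mono power_mono\<close>)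
    next
      case False
      then show ?thesis by (simp add: uniformly_convergent_on_def)
    qed
  qed (intro continuous_intros compact_cball)+
  then obtain l :: "complex \<Rightarrow> complex"
    where l: "uniform_limit (cball 0 r) (\<lambda>N q. \<Prod>n<N. 1 - q ^ Suc n) l sequentially"
    by (auto simp: uniformly_convergent_on_def)
  have "l q = euler_prod q" if "q \<in> cball 0 r" for q
    using tendsto_uniform_limitI[OF l that] euler_prod_LIMSEQ[of q] that r LIMSEQ_unique by force
  with l show ?thesis
    by (auto intro: uniform_limit_cong'[THEN iffD1, rotated 2])
qed

lemma holomorphic_euler_prod: "euler_prod holomorphic_on ball 0 1"
proof -
  have "euler_prod holomorphic_on ball 0 r" if "r < 1" for r
  proof (rule holomorphic_uniform_limit[where f = "\<lambda>N q. \<Prod>n<N. 1 - q ^ Suc n" and F = sequentially])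
    show "\<forall>\<^sub>F N in sequentially. continuous_on (cball 0 r) (\<lambda>q. \<Prod>n<N. 1 - q ^ Suc n :: complex) \<and>
        (\<lambda>q. \<Prod>n<N. 1 - q ^ Suc n) holomorphic_on ball 0 r"
      by (intro always_eventually allI conjI continuous_intros holomorphic_intros)
  qed (use uniform_limit_euler_prod[OF that] in auto)
  moreover have "ball 0 1 = (\<Union>r\<in>{..<1}. ball (0::complex) r)"
    using dense by (fastforce intro: less_trans)
  ultimately show ?thesis
    by (metis (no_types, lifting) holomorphic_on_UN_open lessThan_iff open_ball)
qed

lemma logderiv_euler_prod:
  assumes q: "norm q < 1"
  shows "(\<lambda>n. - of_nat (Suc n) * q ^ n / (1 - q ^ Suc n)) sums (deriv euler_prod q / euler_prod q)"
proof -
  obtain r where r: "norm q < r" "r < 1" using q dense by blast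
  have "(\<lambda>n. deriv (\<lambda>q. 1 - q ^ Suc n) q / (1 - q ^ Suc n)) sums (deriv euler_prod q / euler_prod q)"
  proof (rule logderiv_prodinf_complex_uniform_limit[where A = "ball 0 r"])
    show "uniform_limit (ball 0 r) (\<lambda>n x. \<Prod>k<n. 1 - x ^ Suc k) euler_prod sequentially"
      by (rule uniform_limit_on_subset[OF uniform_limit_euler_prod[OF r(2)]]) auto
  qed (use r euler_prod_nonzero[OF q] in \<open>auto intro!: holomorphic_intros\<close>)
  moreover have "deriv (\<lambda>q. 1 - q ^ Suc n) q = - of_nat (Suc n) * q ^ n" for n
    by (rule DERIV_imp_deriv) (auto intro!: derivative_eq_intros simp: algebra_simps simp del: power_Suc)
  ultimately show ?thesis by simp
qed

lemma double_series_swap: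
  fixes f :: "nat \<Rightarrow> nat \<Rightarrow> real"
  assumes f: "(\<lambda>(m, n). f m n) summable_on UNIV"
    and r: "\<And>m. f m sums r m" and c: "\<And>n. (\<lambda>m. f m n) sums c n"
  shows "\<exists>S. r sums S \<and> c sums S"
proof -
  obtain S where S: "((\<lambda>(m, n). f m n) has_sum S) (UNIV \<times> UNIV)"
    using f by (auto simp: summable_on_def)
  then have S': "((\<lambda>(n, m). f m n) has_sum S) (UNIV \<times> UNIV)"
    using Infinite_Sum.has_sum_swap[where f = "\<lambda>(m, n). f m n" and S = S and A = UNIV and B = UNIV] by simp
  have row: "((\<lambda>n. f m n) has_sum r m) UNIV" for m
  proof -
    have "(\<lambda>n. f m n) summable_on UNIV"
      using summable_on_SigmaD1[of f UNIV "\<lambda>_. UNIV" m] f by simp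
    then show ?thesis
      using r[of m] by (metis has_sum_imp_sums has_sum_infsum sums_unique2)
  qed
  have col: "((\<lambda>m. f m n) has_sum c n) UNIV" for n
  proof -
    have "(\<lambda>m. f m n) summable_on UNIV"
      using summable_on_SigmaD1[of "\<lambda>n m. f m n" UNIV "\<lambda>_. UNIV" n] S'
      by (auto simp: summable_on_def)
    then show ?thesis
      using c[of n] by (metis has_sum_imp_sums has_sum_infsum sums_unique2)
  qed
  have "(r has_sum S) UNIV" "(c has_sum S) UNIV"
    using has_sum_SigmaD[OF S, of r] has_sum_SigmaD[OF S', of c] row col by simp_all
  then show ?thesis using has_sum_imp_sums by blast
qed

lemma of_real_cosh_complex: "complex_of_real (cosh t) = cosh (of_real t)"
  and of_real_sinh_complex: "complex_of_real (sinh t) = sinh (of_real t)"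
  by (simp_all add: cosh_field_def sinh_field_def exp_of_real exp_minus)

section \<open>Partial fractions of coth and its derivative\<close>

lemma Digamma_reflection_complex:
  fixes z :: complex
  assumes z: "z \<notin> \<int>"
  shows "Digamma (1 - z) - Digamma z = pi * cot (pi * z)"
proof -
  have sin: "sin (pi * z) \<noteq> 0"
    using z by (auto simp: sin_eq_0 Ints_def)
  have nz: "z \<notin> \<int>\<^sub>\<le>\<^sub>0" "1 - z \<notin> \<int>\<^sub>\<le>\<^sub>0"
    using z nonpos_Ints_subset_Ints Ints_diff[OF Ints_1, of "1 - z"] by auto
  have "((\<lambda>w. Gamma w * Gamma (1 - w)) has_field_derivative
      (Gamma z * Gamma (1 - z)) * (Digamma z - Digamma (1 - z))) (at z)"
    using nz by (auto intro!: derivative_eq_intros simp: algebra_simps)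
  moreover have "((\<lambda>w. of_real pi / sin (of_real pi * w)) has_field_derivative
      - (pi / sin (pi * z)) * (pi * cot (pi * z))) (at z)"
    using sin by (auto intro!: derivative_eq_intros simp: cot_def field_simps power2_eq_square)
  moreover have "Gamma w * Gamma (1 - w) = of_real pi / sin (of_real pi * w)" for w :: complex
    by (rule Gamma_reflection_complex)
  ultimately have "pi / sin (pi * z) * (Digamma z - Digamma (1 - z)) = pi / sin (pi * z) * (- (pi * cot (pi * z)))"
    by (auto dest: DERIV_unique)
  moreover have "pi / sin (pi * z) \<noteq> 0" using sin by simp
  ultimately have "Digamma z - Digamma (1 - z) = - (pi * cot (pi * z))"
    using mult_left_cancel by blast
  then show ?thesis by (simp add: algebra_simps)
qed

lemma Polygamma_1_reflection_complex:
  fixes z :: complex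
  assumes z: "z \<notin> \<int>"
  shows "Polygamma 1 z + Polygamma 1 (1 - z) = (pi / sin (pi * z))\<^sup>2"
proof -
  have sin: "sin (pi * z) \<noteq> 0"
    using z by (auto simp: sin_eq_0 Ints_def)
  have nz: "z \<notin> \<int>\<^sub>\<le>\<^sub>0" "1 - z \<notin> \<int>\<^sub>\<le>\<^sub>0"
    using z nonpos_Ints_subset_Ints Ints_diff[OF Ints_1, of "1 - z"] by auto
  have "((\<lambda>w. Digamma (1 - w) - Digamma w) has_field_derivative
      - (Polygamma 1 z + Polygamma 1 (1 - z))) (at z)"
    using nz by (auto intro!: derivative_eq_intros simp: algebra_simps)
  then have "((\<lambda>w. of_real pi * cot (of_real pi * w)) has_field_derivative
      - (Polygamma 1 z + Polygamma 1 (1 - z))) (at z)"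
    by (rule has_field_derivative_transform_within_open[of _ _ _ "- \<int>"])
      (use z closed_Ints Digamma_reflection_complex in auto)
  moreover have "((\<lambda>w. of_real pi * cot (of_real pi * w)) has_field_derivative
      - (pi / sin (pi * z))\<^sup>2) (at z)"
    using sin by (auto intro!: derivative_eq_intros DERIV_cot[THEN DERIV_chain2] simp: field_simps power2_eq_square)
  ultimately have "- (Polygamma 1 z + Polygamma 1 (1 - z)) = - (pi / sin (pi * z))\<^sup>2"
    by (rule DERIV_unique)
  then show ?thesis by (simp only: neg_equal_iff_equal)
qed

lemma ii_times_notin_Ints:
  assumes "x \<noteq> (0::real)"
  shows "\<i> * of_real x \<notin> \<int>"
  using assms by (auto simp: Ints_def complex_eq_iff)

lemma coth_partial_fractions:
  fixes x :: real
  assumes x: "x > 0"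
  shows "(\<lambda>n. x / (real (Suc n)^2 + x\<^sup>2)) sums ((pi * cosh (pi * x) / sinh (pi * x) - 1 / x) / 2)"
proof -
  define z where "z = \<i> * complex_of_real x"
  have z: "z \<notin> \<int>" using ii_times_notin_Ints x by (simp add: z_def)
  then have nz: "z \<noteq> 0" "1 + z \<noteq> 0" "1 - z \<noteq> 0"
    by (auto simp: z_def complex_eq_iff)
  have "Digamma (1 - z) - Digamma (1 + z) = pi * cot (pi * z) - 1 / z"
    using Digamma_reflection_complex[OF z] Digamma_plus1[OF nz(1)] by (simp add: add.commute algebra_simps)
  moreover have D: "(\<lambda>k. inverse (of_nat (Suc k)) - inverse (w + of_nat k)) sums (Digamma w + euler_mascheroni)"
    if "w \<noteq> 0" for w :: complex
    using summable_sums[OF summable_Digamma[OF that]] by (simp add: Digamma_def)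
  have "(\<lambda>k. inverse (1 + z + of_nat k) - inverse (1 - z + of_nat k)) sums (Digamma (1 - z) - Digamma (1 + z))"
    using sums_diff[OF D[OF nz(3)] D[OF nz(2)]] by simp
  ultimately have "(\<lambda>k. inverse (1 + z + of_nat k) - inverse (1 - z + of_nat k)) sums (pi * cot (pi * z) - 1 / z)"
    by simp
  then have "(\<lambda>k. (\<i> / 2) * (inverse (1 + z + of_nat k) - inverse (1 - z + of_nat k))) sums
      ((\<i> / 2) * (pi * cot (pi * z) - 1 / z))"
    by (rule sums_mult)
  moreover have "(\<i> / 2) * (inverse (1 + z + of_nat k) - inverse (1 - z + of_nat k)) =
      of_real (x / (real (Suc k)^2 + x\<^sup>2))" for k
  proof -
    have ne: "1 + z + of_nat k \<noteq> 0" "1 - z + of_nat k \<noteq> 0"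
      by (auto simp: z_def complex_eq_iff)
    have prod: "(1 + z + of_nat k) * (1 - z + of_nat k) = of_real (real (Suc k)^2 + x\<^sup>2)"
      by (simp add: z_def power2_eq_square algebra_simps complex_eq_iff)
    have "inverse (1 + z + of_nat k) - inverse (1 - z + of_nat k) =
        (- 2 * z) / ((1 + z + of_nat k) * (1 - z + of_nat k))"
      using ne by (simp add: field_simps)
    then show ?thesis
      unfolding prod by (simp add: z_def)
  qed
  moreover have "(\<i> / 2) * (pi * cot (pi * z) - 1 / z) =
      of_real ((pi * cosh (pi * x) / sinh (pi * x) - 1 / x) / 2)"
  proof -
    have "of_real pi * z = \<i> * of_real (pi * x)" by (simp add: z_def)
    then have c: "cos (of_real pi * z) = of_real (cosh (pi * x))"
      and s: "sin (of_real pi * z) = \<i> * of_real (sinh (pi * x))"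
      by (simp_all add: of_real_cosh_complex of_real_sinh_complex cosh_conv_cos sinh_conv_sin del: of_real_mult)
    show ?thesis
      using x unfolding cot_def c s by (simp add: z_def field_simps)
  qed
  ultimately show ?thesis
    by (simp only: sums_of_real_iff)
qed

lemma inverse_sinh_squared_partial_fractions:
  fixes x :: real
  assumes x: "x > 0"
  shows "(\<lambda>n. (x\<^sup>2 - real (Suc n)^2) / (x\<^sup>2 + real (Suc n)^2)\<^sup>2) sums (((pi / sinh (pi * x))\<^sup>2 - 1 / x\<^sup>2) / 2)"
proof -
  define z where "z = \<i> * complex_of_real x"
  have z: "z \<notin> \<int>" using ii_times_notin_Ints x by (simp add: z_def)
  then have nz: "z \<noteq> 0" "1 + z \<noteq> 0" "1 - z \<noteq> 0"
    by (auto simp: z_def complex_eq_iff)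
  have inv_sq: "inverse (a\<^sup>2) + inverse (b\<^sup>2) = (a\<^sup>2 + b\<^sup>2) / (a * b)\<^sup>2"
    if "a \<noteq> 0" "b \<noteq> 0" for a b :: complex
    using that by (simp add: field_simps)
  have P: "(\<lambda>k. inverse ((w + of_nat k)\<^sup>2)) sums Polygamma 1 w" if "w \<noteq> 0" for w :: complex
    using Polygamma_LIMSEQ[OF that, of 1] by (simp add: power2_eq_square)
  have "(\<lambda>k. inverse ((1 + z + of_nat k)\<^sup>2) + inverse ((1 - z + of_nat k)\<^sup>2)) sums
      (Polygamma 1 (1 + z) + Polygamma 1 (1 - z))"
    using P nz by (intro sums_add) auto
  moreover have "Polygamma 1 (1 + z) = Polygamma 1 z - 1 / z\<^sup>2"
    using Polygamma_plus1[OF nz(1), of 1] by (simp add: add.commute power2_eq_square)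
  then have "Polygamma 1 (1 + z) + Polygamma 1 (1 - z) = (pi / sin (pi * z))\<^sup>2 - 1 / z\<^sup>2"
    using Polygamma_1_reflection_complex[OF z] by (simp add: algebra_simps)
  ultimately have "(\<lambda>k. inverse ((1 + z + of_nat k)\<^sup>2) + inverse ((1 - z + of_nat k)\<^sup>2)) sums
      ((pi / sin (pi * z))\<^sup>2 - 1 / z\<^sup>2)"
    by simp
  then have "(\<lambda>k. (- 1 / 2) * (inverse ((1 + z + of_nat k)\<^sup>2) + inverse ((1 - z + of_nat k)\<^sup>2))) sums
      ((- 1 / 2) * ((pi / sin (pi * z))\<^sup>2 - 1 / z\<^sup>2))"
    by (rule sums_mult)
  moreover have "(- 1 / 2) * (inverse ((1 + z + of_nat k)\<^sup>2) + inverse ((1 - z + of_nat k)\<^sup>2)) =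
      of_real ((x\<^sup>2 - real (Suc k)^2) / (x\<^sup>2 + real (Suc k)^2)\<^sup>2)" for k
  proof -
    have ne: "1 + z + of_nat k \<noteq> 0" "1 - z + of_nat k \<noteq> 0"
      by (auto simp: z_def complex_eq_iff)
    have prod: "(1 + z + of_nat k) * (1 - z + of_nat k) = of_real (x\<^sup>2 + real (Suc k)^2)"
      by (simp add: z_def power2_eq_square algebra_simps complex_eq_iff)
    have "inverse ((1 + z + of_nat k)\<^sup>2) + inverse ((1 - z + of_nat k)\<^sup>2) =
        ((1 + z + of_nat k)\<^sup>2 + (1 - z + of_nat k)\<^sup>2) / ((1 + z + of_nat k) * (1 - z + of_nat k))\<^sup>2"
      by (rule inv_sq[OF ne])
    also have "(1 + z + of_nat k)\<^sup>2 + (1 - z + of_nat k)\<^sup>2 = - 2 * of_real (x\<^sup>2 - real (Suc k)^2)"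
      by (simp add: z_def power2_eq_square algebra_simps complex_eq_iff)
    finally have eq: "inverse ((1 + z + of_nat k)\<^sup>2) + inverse ((1 - z + of_nat k)\<^sup>2) =
        - 2 * of_real (x\<^sup>2 - real (Suc k)^2) / (of_real (x\<^sup>2 + real (Suc k)^2))\<^sup>2"
      unfolding prod .
    have "(- 1 / 2) * (- 2 * a / b) = a / b" for a b :: complex by simp
    then show ?thesis
      by (simp only: eq of_real_divide of_real_power)
  qed
  moreover have "(- 1 / 2) * ((pi / sin (pi * z))\<^sup>2 - 1 / z\<^sup>2) =
      of_real (((pi / sinh (pi * x))\<^sup>2 - 1 / x\<^sup>2) / 2)"
  proof -
    have "of_real pi * z = \<i> * of_real (pi * x)" by (simp add: z_def)
    then have s: "sin (of_real pi * z) = \<i> * of_real (sinh (pi * x))"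
      by (simp add: of_real_sinh_complex sinh_conv_sin del: of_real_mult)
    show ?thesis
      using x unfolding s by (simp add: z_def field_simps power_mult_distrib)
  qed
  ultimately show ?thesis
    by (simp only: sums_of_real_iff)
qed

section \<open>The inversion formula for the Eisenstein series of weight two\<close>

text \<open>
  The double series of \<open>a\<close> depends on the order of summation. It becomes absolutely convergent after
  subtraction of the increments of \<open>T\<close>, whose iterated sums are explicit: 0 when summing over \<open>n\<close> first,
  and the limit of a coth when summing over \<open>m\<close> first.
\<close>

lemma eisenstein_correction_summable:
  fixes y :: real
  assumes y: "y > 0"
  defines "T \<equiv> \<lambda>m n. real n / (real (Suc m)^2 * y\<^sup>2 + real n^2)"
  defines "a \<equiv> \<lambda>m n. (real (Suc m)^2 * y\<^sup>2 - real (Suc n)^2) / (real (Suc m)^2 * y\<^sup>2 + real (Suc n)^2)\<^sup>2"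
  shows "(\<lambda>(m, n). a m n - (T m (Suc n) - T m n)) summable_on UNIV"
proof -
  define K where "K = max (3 / y\<^sup>2) 2"
  have K: "K > 0" by (simp add: K_def)
  have bound: "\<bar>a m n - (T m (Suc n) - T m n)\<bar> \<le> 3 * K\<^sup>2 * (real (Suc m) powr (-3/2) * real (Suc n) powr (-3/2))" for m n
  proof -
    define M N s c where "M = real (Suc m)" and "N = real (Suc n)" and "s = real n" and "c = M\<^sup>2 * y\<^sup>2"
    have pos: "M \<ge> 1" "N \<ge> 1" "s \<ge> 0" "N = s + 1" "c > 0"
      using y by (auto simp: M_def N_def s_def c_def)
    have pos': "c + N\<^sup>2 > 0" "c + s\<^sup>2 > 0"
      using pos by (auto intro: add_pos_nonneg)
    have T: "T m (Suc n) = N / (c + N\<^sup>2)" "T m n = s / (c + s\<^sup>2)" and a: "a m n = (c - N\<^sup>2) / (c + N\<^sup>2)\<^sup>2"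
      by (simp_all only: T_def a_def M_def N_def s_def c_def)
    have "a m n - (T m (Suc n) - T m n) = (N\<^sup>2 * s - c * (2 * N + s)) / ((c + N\<^sup>2)\<^sup>2 * (c + s\<^sup>2))"
    proof -
      have "N / p - s / d = (N * d - s * p) * p / (p\<^sup>2 * d)" if "p > 0" "d > 0" for p d
        using that by (simp add: power2_eq_square diff_frac_eq)
      moreover have "N * (c + s\<^sup>2) - s * (c + N\<^sup>2) = c - N * s"
        by (simp add: power2_eq_square pos(4) algebra_simps)
      ultimately have "N / (c + N\<^sup>2) - s / (c + s\<^sup>2) = (c - N * s) * (c + N\<^sup>2) / ((c + N\<^sup>2)\<^sup>2 * (c + s\<^sup>2))"
        using pos' by metis
      moreover have "(c - N\<^sup>2) / (c + N\<^sup>2)\<^sup>2 = (c - N\<^sup>2) * (c + s\<^sup>2) / ((c + N\<^sup>2)\<^sup>2 * (c + s\<^sup>2))"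
        using pos' by simp
      moreover have "(c - N\<^sup>2) * (c + s\<^sup>2) - (c - N * s) * (c + N\<^sup>2) = N\<^sup>2 * s - c * (2 * N + s)"
        by (simp add: power2_eq_square pos(4) algebra_simps)
      ultimately show ?thesis
        unfolding T a by (simp only: diff_divide_distrib[symmetric])
    qed
    also have "\<bar>\<dots>\<bar> \<le> (3 * N * (c + N\<^sup>2)) / ((c + N\<^sup>2)\<^sup>2 * (c + s\<^sup>2))"
    proof -
      have "N\<^sup>2 * s \<le> N\<^sup>2 * N" "c * (2 * N + s) \<le> c * (3 * N)" "0 \<le> N\<^sup>2 * s" "0 \<le> c * (2 * N + s)"
        using pos by (intro mult_left_mono mult_nonneg_nonneg; simp)+
      then have "\<bar>N\<^sup>2 * s - c * (2 * N + s)\<bar> \<le> N\<^sup>2 * N + c * (3 * N)"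
        by linarith
      also have "\<dots> \<le> 3 * N * (c + N\<^sup>2)"
        using pos by (simp add: algebra_simps)
      finally show ?thesis
        using pos' by (simp add: abs_div divide_right_mono)
    qed
    also have "\<dots> = 3 * N / ((c + N\<^sup>2) * (c + s\<^sup>2))"
      using pos' by (simp add: power2_eq_square)
    also have "\<dots> \<le> 3 * N / (((M\<^sup>2 + N\<^sup>2) / K) * ((M\<^sup>2 + N\<^sup>2) / K))"
    proof -
      have "1 \<le> M\<^sup>2" using pos by simp
      then have "N\<^sup>2 \<le> 2 * s\<^sup>2 + 2 * M\<^sup>2"
        using zero_le_power2[of "s - 1"] unfolding pos(4) by (simp add: power2_eq_square algebra_simps)
      then have "M\<^sup>2 + N\<^sup>2 \<le> 3 * M\<^sup>2 + 2 * s\<^sup>2" by simp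
      also have "\<dots> = (3 / y\<^sup>2) * c + 2 * s\<^sup>2" using y by (simp add: c_def)
      also have "\<dots> \<le> K * c + K * s\<^sup>2"
        using pos by (intro add_mono mult_right_mono) (auto simp: K_def)
      finally have 1: "(M\<^sup>2 + N\<^sup>2) / K \<le> c + s\<^sup>2"
        using K by (simp add: field_simps)
      also have "\<dots> \<le> c + N\<^sup>2" using pos by (intro add_mono power_mono) auto
      finally have "(M\<^sup>2 + N\<^sup>2) / K \<le> c + N\<^sup>2" .
      moreover have "0 < (M\<^sup>2 + N\<^sup>2) / K"
        using K pos by (intro divide_pos_pos add_pos_nonneg) auto
      moreover note 1 pos'
      ultimately show ?thesis
        using pos(2) by (intro divide_left_mono mult_mono mult_pos_pos) auto
    qed
    also have "\<dots> = 3 * K\<^sup>2 * (N / (M\<^sup>2 + N\<^sup>2)\<^sup>2)"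
      by (simp add: power2_eq_square)
    also have "N / (M\<^sup>2 + N\<^sup>2)\<^sup>2 \<le> M powr (-3/2) * N powr (-3/2)"
    proof -
      define r where "r = sqrt (M\<^sup>2 + N\<^sup>2)"
      have r: "M \<le> r" "N \<le> r" "r > 0" using pos by (auto simp: r_def real_le_rsqrt add_pos_pos)
      have "(N * M powr (3/2)) * N powr (3/2) \<le> (r * r powr (3/2)) * r powr (3/2)"
        using r pos by (intro mult_mono powr_mono2) auto
      also have "\<dots> = r powr (1 + 3/2 + 3/2)"
        using r by (simp only: powr_add powr_one)
      also have "\<dots> = r ^ 4"
        using r by (simp add: powr_numeral)
      also have "\<dots> = (M\<^sup>2 + N\<^sup>2)\<^sup>2"
        by (simp add: r_def power4_eq_xxxx power2_eq_square)
      finally have "N \<le> (M\<^sup>2 + N\<^sup>2)\<^sup>2 / (M powr (3/2) * N powr (3/2))"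
        using pos by (simp add: field_simps)
      then show ?thesis
        using pos by (simp add: powr_minus_divide field_simps add_pos_pos)
    qed
    finally show ?thesis
      by (simp add: M_def N_def mult_left_mono)
  qed
  have "summable (\<lambda>n. real (Suc n) powr (-3/2))"
    by (subst summable_Suc_iff) (simp add: summable_real_powr_iff)
  then have s: "(\<lambda>n. real (Suc n) powr (-3/2)) summable_on UNIV"
    by (simp add: summable_on_UNIV_nonneg_real_iff)
  have "(\<lambda>(m, n). real (Suc m) powr (-3/2) * real (Suc n) powr (-3/2)) summable_on UNIV \<times> UNIV"
  proof (rule summable_on_SigmaI)
    fix m
    show "((\<lambda>n. case (m, n) of (m, n) \<Rightarrow> real (Suc m) powr (-3/2) * real (Suc n) powr (-3/2)) has_sum
        real (Suc m) powr (-3/2) * (\<Sum>\<^sub>\<infinity>n. real (Suc n) powr (-3/2))) UNIV"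
      using s by (auto intro!: has_sum_cmult_right has_sum_infsum)
  qed (use s in \<open>auto intro!: summable_on_cmult_left\<close>)
  then have "(\<lambda>p. 3 * K\<^sup>2 * (case p of (m, n) \<Rightarrow> real (Suc m) powr (-3/2) * real (Suc n) powr (-3/2))) summable_on UNIV"
    by (intro summable_on_cmult_right) simp
  then have "(\<lambda>p. norm (case p of (m, n) \<Rightarrow> a m n - (T m (Suc n) - T m n))) summable_on UNIV"
    by (rule Infinite_Sum.abs_summable_on_comparison_test') (use bound in \<open>simp add: case_prod_unfold\<close>)
  then show ?thesis
    by (rule abs_summable_summable)
qed

definition sinh_sum :: "real \<Rightarrow> real" where
  "sinh_sum y = (\<Sum>m. (pi / sinh (pi * (real (Suc m) * y)))\<^sup>2)"

lemma sinh_sum_inversion: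
  fixes y :: real
  assumes y: "y > 0"
  shows "summable (\<lambda>m. (pi / sinh (pi * (real (Suc m) * y)))\<^sup>2)"
    and "sinh_sum (1 / y) + y\<^sup>2 * sinh_sum y = pi\<^sup>2 / 6 * (1 + y\<^sup>2) - pi * y"
proof -
  define T where "T = (\<lambda>m n. real n / (real (Suc m)^2 * y\<^sup>2 + real n^2))"
  define a where "a = (\<lambda>m n. (real (Suc m)^2 * y\<^sup>2 - real (Suc n)^2) / (real (Suc m)^2 * y\<^sup>2 + real (Suc n)^2)\<^sup>2)"
  define U where "U = (\<lambda>n. if n = 0 then 0 else (pi * cosh (pi * (n / y)) / sinh (pi * (n / y)) - y / n) / (2 * y))"
  define \<alpha> where "\<alpha> = (\<lambda>m. ((pi / sinh (pi * (real (Suc m) * y)))\<^sup>2 - 1 / (real (Suc m) * y)\<^sup>2) / 2)"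
  define \<gamma> where "\<gamma> = (\<lambda>n. - ((pi / sinh (pi * (real (Suc n) / y)))\<^sup>2 - (y / real (Suc n))\<^sup>2) / (2 * y\<^sup>2))"
  have row: "(\<lambda>n. a m n) sums \<alpha> m" for m
    using inverse_sinh_squared_partial_fractions[of "real (Suc m) * y"] y
    by (simp add: a_def \<alpha>_def power_mult_distrib)
  have col: "(\<lambda>m. a m n) sums \<gamma> n" for n
  proof -
    define x where "x = real (Suc n) / y"
    have x: "x > 0" "real (Suc n) = x * y" using y by (simp_all add: x_def)
    have "a m n = (- 1 / y\<^sup>2) * ((x\<^sup>2 - real (Suc m)^2) / (x\<^sup>2 + real (Suc m)^2)\<^sup>2)" for m
    proof -
      have "a m n = (y\<^sup>2 * (real (Suc m)^2 - x\<^sup>2)) / (y\<^sup>2 * (x\<^sup>2 + real (Suc m)^2))\<^sup>2"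
        unfolding a_def x(2) by (simp add: power_mult_distrib algebra_simps)
      also have "\<dots> = (real (Suc m)^2 - x\<^sup>2) / (y\<^sup>2 * (x\<^sup>2 + real (Suc m)^2)\<^sup>2)"
      proof -
        have "Y * A / (Y * B)\<^sup>2 = A / (Y * B\<^sup>2)" if "Y \<noteq> 0" for Y A B :: real
          using that by (simp add: power2_eq_square)
        moreover have "y\<^sup>2 \<noteq> 0" using y by simp
        ultimately show ?thesis by blast
      qed
      also have "\<dots> = (- 1 / y\<^sup>2) * ((x\<^sup>2 - real (Suc m)^2) / (x\<^sup>2 + real (Suc m)^2)\<^sup>2)"
      proof -
        have "(p - q) / (Y * B) = (- 1 / Y) * ((q - p) / B)" for p q Y B :: real
          by (cases "Y = 0"; cases "B = 0") (simp_all add: field_simps)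
        then show ?thesis by blast
      qed
      finally show ?thesis .
    qed
    moreover have "\<gamma> n = (- 1 / y\<^sup>2) * (((pi / sinh (pi * x))\<^sup>2 - 1 / x\<^sup>2) / 2)"
    proof -
      have "1 / x\<^sup>2 = (y / real (Suc n))\<^sup>2" by (simp add: x_def power_divide)
      moreover have "- (p - q) / (2 * Y) = (- 1 / Y) * ((p - q) / 2)" for p q Y :: real
        by (cases "Y = 0") (simp_all add: field_simps)
      ultimately show ?thesis unfolding \<gamma>_def x_def by metis
    qed
    ultimately show ?thesis
      using sums_mult[OF inverse_sinh_squared_partial_fractions[OF x(1)], of "- 1 / y\<^sup>2"] by simp
  qed
  have rowT: "(\<lambda>n. T m (Suc n) - T m n) sums 0" for m
  proof -
    have "(\<lambda>n. T m n) \<longlonglongrightarrow> 0"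
      unfolding T_def using y by real_asymp
    from telescope_sums[OF this] show ?thesis by (simp add: T_def)
  qed
  have colT: "(\<lambda>m. T m n) sums U n" for n
  proof (cases "n = 0")
    case False
    define x where "x = real n / y"
    have x: "x > 0" "real n = x * y" using y False by (simp_all add: x_def)
    have "T m n = (1 / y) * (x / (real (Suc m)^2 + x\<^sup>2))" for m
    proof -
      have "T m n = (y * x) / (y * (y * (real (Suc m)^2 + x\<^sup>2)))"
        unfolding T_def x(2) by (simp add: power2_eq_square algebra_simps)
      then show ?thesis using y by simp
    qed
    moreover have "U n = (1 / y) * ((pi * cosh (pi * x) / sinh (pi * x) - 1 / x) / 2)"
      using y False by (simp add: U_def x_def)
    ultimately show ?thesis
      using sums_mult[OF coth_partial_fractions[OF x(1)], of "1 / y"] by simp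
  qed (simp add: T_def U_def)
  have Usums: "(\<lambda>n. U (Suc n) - U n) sums (pi / (2 * y))"
  proof -
    have "(\<lambda>n. (pi * cosh (pi * (real n / y)) / sinh (pi * (real n / y)) - y / real n) / (2 * y)) \<longlonglongrightarrow> pi / (2 * y)"
      unfolding cosh_field_def sinh_field_def using y by real_asymp (simp add: field_simps)
    then have "U \<longlonglongrightarrow> pi / (2 * y)"
      by (rule Lim_transform_eventually) (auto simp: U_def intro: eventually_mono[OF eventually_gt_at_top[of 0]])
    from telescope_sums[OF this] show ?thesis by (simp add: U_def)
  qed
  have "(\<lambda>(m, n). a m n - (T m (Suc n) - T m n)) summable_on UNIV"
    unfolding a_def T_def by (rule eisenstein_correction_summable[OF y])
  from double_series_swap[OF this]
  have swap: "\<exists>S. r sums S \<and> c sums S"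
    if "\<And>m. (\<lambda>n. a m n - (T m (Suc n) - T m n)) sums r m"
      "\<And>n. (\<lambda>m. a m n - (T m (Suc n) - T m n)) sums c n" for r c
    using that .
  have "(\<lambda>n. a m n - (T m (Suc n) - T m n)) sums \<alpha> m" for m
    using sums_diff[OF row rowT, of m m] by simp
  moreover have "(\<lambda>m. a m n - (T m (Suc n) - T m n)) sums (\<gamma> n - (U (Suc n) - U n))" for n
    by (intro sums_diff col colT)
  ultimately have "\<exists>S. \<alpha> sums S \<and> (\<lambda>n. \<gamma> n - (U (Suc n) - U n)) sums S"
    by (rule swap)
  then obtain S where S: "\<alpha> sums S" "(\<lambda>n. \<gamma> n - (U (Suc n) - U n)) sums S"
    by (elim exE conjE)
  have \<gamma>: "\<gamma> sums (S + pi / (2 * y))"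
    using sums_add[OF S(2) Usums] by simp
  have sq: "(\<lambda>n. 1 / real (Suc n)^2) sums (pi\<^sup>2 / 6)"
    using inverse_squares_sums by (simp add: add.commute)
  have "2 * \<alpha> m + 1 / real (Suc m)^2 / y\<^sup>2 = (pi / sinh (pi * (real (Suc m) * y)))\<^sup>2" for m
  proof -
    have "2 * ((p - q) / 2) + q = p" for p q :: real by (simp add: field_simps)
    then show ?thesis by (simp only: \<alpha>_def power_mult_distrib divide_divide_eq_left)
  qed
  with sums_add[OF sums_mult[OF S(1), of 2] sums_divide[OF sq, of "y\<^sup>2"]]
  have A: "(\<lambda>m. (pi / sinh (pi * (real (Suc m) * y)))\<^sup>2) sums (2 * S + pi\<^sup>2 / 6 / y\<^sup>2)"
    by (simp only:)
  have "- 2 * y\<^sup>2 * \<gamma> n + y\<^sup>2 * (1 / real (Suc n)^2) = (pi / sinh (pi * (real (Suc n) * (1 / y))))\<^sup>2" for n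
  proof -
    have "- 2 * Y * (- (p - q) / (2 * Y)) + q = p" if "Y \<noteq> 0" for Y p q :: real
      using that by (simp add: field_simps)
    then have "- 2 * y\<^sup>2 * \<gamma> n + (y / real (Suc n))\<^sup>2 = (pi / sinh (pi * (real (Suc n) / y)))\<^sup>2"
      unfolding \<gamma>_def using y by simp
    then show ?thesis by (simp add: power_divide)
  qed
  with sums_add[OF sums_mult[OF \<gamma>, of "- 2 * y\<^sup>2"] sums_mult[OF sq, of "y\<^sup>2"]]
  have B: "(\<lambda>n. (pi / sinh (pi * (real (Suc n) * (1 / y))))\<^sup>2) sums
      (- 2 * y\<^sup>2 * (S + pi / (2 * y)) + y\<^sup>2 * (pi\<^sup>2 / 6))"
    by (simp only:)
  show "summable (\<lambda>m. (pi / sinh (pi * (real (Suc m) * y)))\<^sup>2)"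
    using A by (rule sums_summable)
  have "sinh_sum y = 2 * S + pi\<^sup>2 / 6 / y\<^sup>2"
    "sinh_sum (1 / y) = - 2 * y\<^sup>2 * (S + pi / (2 * y)) + y\<^sup>2 * (pi\<^sup>2 / 6)"
    unfolding sinh_sum_def using A B by (simp_all only: sums_iff)
  moreover have "y\<^sup>2 * (2 * S + pi\<^sup>2 / 6 / y\<^sup>2) = 2 * y\<^sup>2 * S + pi\<^sup>2 / 6"
    using y by (simp add: distrib_left)
  moreover have "- 2 * y\<^sup>2 * (S + pi / (2 * y)) = - 2 * y\<^sup>2 * S - pi * y"
    using y by (simp add: field_simps power2_eq_square)
  ultimately show "sinh_sum (1 / y) + y\<^sup>2 * sinh_sum y = pi\<^sup>2 / 6 * (1 + y\<^sup>2) - pi * y"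
    by (simp add: algebra_simps)
qed

section \<open>Modularity of the discriminant\<close>

lemma lambert_sinh_sum:
  fixes y :: real
  assumes y: "y > 0"
  defines "q \<equiv> exp (- 2 * pi * y)"
  shows "(\<lambda>n. real (Suc n) * q ^ Suc n / (1 - q ^ Suc n)) sums (sinh_sum y / (4 * pi\<^sup>2))"
proof -
  have q: "0 < q" "q < 1" using y by (simp_all add: q_def)
  define f where "f = (\<lambda>m n. real (Suc n) * (q ^ Suc m) ^ Suc n)"
  define r where "r = (\<lambda>m. (pi / sinh (pi * (real (Suc m) * y)))\<^sup>2 / (4 * pi\<^sup>2))"
  have pow: "0 < q ^ Suc m" "q ^ Suc m < 1" for m
    using q by (simp_all add: power_Suc_less_one del: power_Suc)
  have row: "f m sums r m" for m
  proof -
    define x where "x = q ^ Suc m"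
    define t where "t = pi * (real (Suc m) * y)"
    have x: "0 < x" "x < 1" using pow[of m] by (simp_all only: x_def)
    have xt: "x = exp (- t) * exp (- t)"
      unfolding x_def q_def t_def by (simp add: exp_add[symmetric] exp_of_nat_mult[symmetric] algebra_simps del: power_Suc)
    have "t > 0" using y by (simp add: t_def)
    then have sinh: "sinh t > 0" by simp
    have "2 * sinh t = exp t - exp (- t)" by (simp add: sinh_field_def)
    then have "exp (- t) * (2 * sinh t) = exp (- t) * exp t - exp (- t) * exp (- t)"
      by (simp only: right_diff_distrib)
    also have "exp (- t) * exp t = 1" by (simp add: exp_minus)
    finally have "exp (- t) * (2 * sinh t) = 1 - x" by (simp add: xt)
    then have "(1 - x)\<^sup>2 = (exp (- t) * (2 * sinh t))\<^sup>2" by simp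
    also have "\<dots> = x * (4 * (sinh t)\<^sup>2)"
      unfolding xt power_mult_distrib by (simp add: power2_eq_square)
    finally have "(1 - x)\<^sup>2 = x * (4 * (sinh t)\<^sup>2)" .
    then have "x / (1 - x)\<^sup>2 = 1 / (4 * (sinh t)\<^sup>2)"
      using x by simp
    also have "\<dots> = r m"
      unfolding r_def t_def[symmetric] by (simp add: power_divide)
    finally have r: "x / (1 - x)\<^sup>2 = r m" .
    have "(\<lambda>n. x * (real (Suc n) * x ^ n)) sums (x * (1 / (1 - x)\<^sup>2))"
      using x by (intro sums_mult geometric_deriv_sums) simp
    moreover have "f m = (\<lambda>n. x * (real (Suc n) * x ^ n))"
      unfolding f_def x_def[symmetric] by (simp add: fun_eq_iff)
    ultimately show ?thesis
      using r by simp
  qed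
  have col: "(\<lambda>m. f m n) sums (real (Suc n) * q ^ Suc n / (1 - q ^ Suc n))" for n
  proof -
    define x where "x = q ^ Suc n"
    have x: "0 < x" "x < 1" using pow[of n] by (simp_all only: x_def)
    have "(\<lambda>m. real (Suc n) * x * x ^ m) sums (real (Suc n) * x * (1 / (1 - x)))"
      using x by (intro sums_mult geometric_sums) simp
    moreover have "f m n = real (Suc n) * x * x ^ m" for m
    proof -
      have "(q ^ Suc m) ^ Suc n = x ^ Suc m"
        unfolding x_def by (simp only: power_mult[symmetric] mult.commute)
      then show ?thesis by (simp add: f_def del: power_Suc) simp
    qed
    ultimately show ?thesis by (simp add: x_def del: power_Suc)
  qed
  have r_sums: "r sums (sinh_sum y / (4 * pi\<^sup>2))"
    unfolding r_def sinh_sum_def by (intro sums_divide summable_sums sinh_sum_inversion(1) y)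
  have f_nonneg: "f m n \<ge> 0" for m n using q by (simp add: f_def)
  have "(\<lambda>(m, n). f m n) summable_on UNIV \<times> UNIV"
  proof (rule summable_on_SigmaI)
    show "r summable_on UNIV"
      using r_sums by (simp add: summable_on_UNIV_nonneg_real_iff r_def sums_iff)
    show "((\<lambda>n. case (m, n) of (m, n) \<Rightarrow> f m n) has_sum r m) UNIV" for m
      using sums_nonneg_imp_has_sum[OF row f_nonneg] by simp
  qed (simp add: f_nonneg)
  then have "(\<lambda>(m, n). f m n) summable_on UNIV" by simp
  from double_series_swap[OF this row col]
  obtain S where S: "r sums S" "(\<lambda>n. real (Suc n) * q ^ Suc n / (1 - q ^ Suc n)) sums S"
    by (elim exE conjE)
  show ?thesis using S(2) unfolding sums_unique2[OF S(1) r_sums] .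
qed

definition disc_q :: "complex \<Rightarrow> complex" where
  "disc_q q = q * euler_prod q ^ 24"

definition disc_im :: "real \<Rightarrow> real" where
  "disc_im y = Re (disc_q (of_real (exp (- 2 * pi * y))))"

lemma holomorphic_disc_q: "disc_q holomorphic_on ball 0 1"
  unfolding disc_q_def by (intro holomorphic_intros holomorphic_euler_prod)

lemma euler_prod_of_real:
  assumes "0 \<le> q" "q < 1"
  shows "\<exists>p>0. euler_prod (of_real q) = of_real p"
proof -
  have lim: "(\<lambda>N. of_real (\<Prod>n<N. 1 - q ^ Suc n)) \<longlonglongrightarrow> euler_prod (of_real q)"
    using euler_prod_LIMSEQ[of "of_real q"] assms by simp
  then have "euler_prod (of_real q) \<in> \<real>"
    by (rule closed_sequentially[OF closed_complex_Reals, rotated]) auto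
  then obtain p where p: "euler_prod (of_real q) = of_real p" by (auto elim: Reals_cases)
  have "(\<lambda>N. \<Prod>n<N. 1 - q ^ Suc n) \<longlonglongrightarrow> p"
    using tendsto_Re[OF lim] unfolding p by (simp only: Re_complex_of_real)
  moreover have "0 \<le> (\<Prod>n<N. 1 - q ^ Suc n)" for N
    using assms by (intro prod_nonneg) (auto simp: power_le_one simp del: power_Suc)
  ultimately have "p \<ge> 0"
    by (intro LIMSEQ_le_const) auto
  moreover have "p \<noteq> 0"
    using euler_prod_nonzero[of "of_real q"] assms p by auto
  ultimately show ?thesis using p by (intro exI[of _ p]) simp
qed

lemma disc_im_pos: "y > 0 \<Longrightarrow> disc_im y > 0"
  and of_real_disc_im: "y > 0 \<Longrightarrow> complex_of_real (disc_im y) = disc_q (of_real (exp (- 2 * pi * y)))"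
proof -
  assume y: "y > 0"
  then obtain p where "p > 0" "euler_prod (of_real (exp (- 2 * pi * y))) = of_real p"
    using euler_prod_of_real[of "exp (- 2 * pi * y)"] by auto
  then have "disc_q (of_real (exp (- 2 * pi * y))) = of_real (exp (- 2 * pi * y) * p ^ 24)" "p > 0"
    by (simp_all add: disc_q_def)
  then show "disc_im y > 0" "complex_of_real (disc_im y) = disc_q (of_real (exp (- 2 * pi * y)))"
    by (simp_all add: disc_im_def)
qed

lemma disc_im_deriv:
  assumes y: "y > 0"
  shows "(disc_im has_real_derivative disc_im y * (12 / pi * sinh_sum y - 2 * pi)) (at y)"
proof -
  define q where "q = complex_of_real (exp (- 2 * pi * y))"
  have q: "norm q < 1" "q \<noteq> 0" using y by (simp_all add: q_def)
  define P' where "P' = deriv euler_prod q"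
  have P: "euler_prod q \<noteq> 0" by (rule euler_prod_nonzero[OF q(1)])
  have "(euler_prod has_field_derivative P') (at q)"
    unfolding P'_def using q(1) by (intro holomorphic_derivI[OF holomorphic_euler_prod]) auto
  then have D: "(disc_q has_field_derivative (disc_q q * (1 / q + 24 * (P' / euler_prod q)))) (at q)"
  proof -
    assume D0: "(euler_prod has_field_derivative P') (at q)"
    define c where "c = euler_prod q ^ 23"
    have "euler_prod q ^ 24 = euler_prod q * c"
      using power_Suc[of "euler_prod q" 23] by (simp add: c_def)
    then have "disc_q q * (1 / q + 24 * (P' / euler_prod q)) = 1 * euler_prod q ^ 24 + (24 * c * P') * q"
      using q(2) P by (simp add: disc_q_def field_simps)
    moreover have "((\<lambda>q. euler_prod q ^ 24) has_field_derivative 24 * c * P') (at q)"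
      using DERIV_power[OF D0, of 24] by (simp add: c_def mult_ac)
    then have "((\<lambda>q. q * euler_prod q ^ 24) has_field_derivative 1 * euler_prod q ^ 24 + (24 * c * P') * q) (at q)"
      by (rule DERIV_mult[OF DERIV_ident])
    ultimately show ?thesis
      by (simp only: disc_q_def[abs_def])
  qed
  have disc_q_q: "disc_q q = of_real (disc_im y)"
    unfolding q_def by (rule of_real_disc_im[OF y, symmetric])
  have lambert: "(\<lambda>n. complex_of_real (real (Suc n) * exp (- 2 * pi * y) ^ Suc n / (1 - exp (- 2 * pi * y) ^ Suc n))) sums
      of_real (sinh_sum y / (4 * pi\<^sup>2))"
    by (rule sums_of_real[OF lambert_sinh_sum[OF y]])
  have eq: "complex_of_real (real (Suc n) * exp (- 2 * pi * y) ^ Suc n / (1 - exp (- 2 * pi * y) ^ Suc n)) =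
      - q * (- of_nat (Suc n) * q ^ n / (1 - q ^ Suc n))" for n
  proof -
    have "complex_of_real (real (Suc n) * exp (- 2 * pi * y) ^ Suc n / (1 - exp (- 2 * pi * y) ^ Suc n)) =
        of_nat (Suc n) * q ^ Suc n / (1 - q ^ Suc n)"
      unfolding q_def by (simp del: power_Suc of_nat_Suc)
    moreover have "a * (q * b) / c = - q * (- a * b / c)" for a b c :: complex by simp
    ultimately show ?thesis by (simp only: power_Suc)
  qed
  have "(\<lambda>n. - q * (- of_nat (Suc n) * q ^ n / (1 - q ^ Suc n))) sums of_real (sinh_sum y / (4 * pi\<^sup>2))"
    using lambert unfolding eq .
  moreover have "(\<lambda>n. - q * (- of_nat (Suc n) * q ^ n / (1 - q ^ Suc n))) sums (- q * (P' / euler_prod q))"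
    unfolding P'_def by (intro sums_mult logderiv_euler_prod q)
  ultimately have "- q * (P' / euler_prod q) = of_real (sinh_sum y / (4 * pi\<^sup>2))"
    by (rule sums_unique2[rotated])
  then have qP: "q * (P' / euler_prod q) = - of_real (sinh_sum y / (4 * pi\<^sup>2))"
    by (metis minus_mult_left minus_minus)
  have "((\<lambda>y. exp (- 2 * pi * y)) has_real_derivative exp (- 2 * pi * y) * (- 2 * pi)) (at y)"
    by (auto intro!: derivative_eq_intros)
  from has_vector_derivative_of_real[OF this, where ?'a = complex]
  have "((\<lambda>y. complex_of_real (exp (- 2 * pi * y))) has_vector_derivative q * (- 2 * pi)) (at y)"
    by (simp add: q_def)
  from field_vector_diff_chain_at[OF this D[unfolded q_def]]
  have "((\<lambda>y. disc_q (complex_of_real (exp (- 2 * pi * y)))) has_vector_derivative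
      (q * (- 2 * pi)) * (disc_q q * (1 / q + 24 * (P' / euler_prod q)))) (at y)"
    unfolding o_def q_def[symmetric] .
  also have "(q * (- 2 * pi)) * (disc_q q * (1 / q + 24 * (P' / euler_prod q))) =
      - 2 * pi * disc_q q * (q * (1 / q + 24 * (P' / euler_prod q)))"
    by (simp only: mult_ac)
  also have "q * (1 / q + 24 * (P' / euler_prod q)) = 1 + 24 * (q * (P' / euler_prod q))"
    using q(2) by (simp add: distrib_left)
  also have "- 2 * pi * disc_q q * (1 + 24 * (q * (P' / euler_prod q))) =
      of_real (- 2 * pi * disc_im y * (1 + 24 * - (sinh_sum y / (4 * pi\<^sup>2))))"
    unfolding qP disc_q_q by simp
  also have "- 2 * pi * disc_im y * (1 + 24 * - (sinh_sum y / (4 * pi\<^sup>2))) =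
      disc_im y * (12 / pi * sinh_sum y - 2 * pi)"
    by (simp add: field_simps power2_eq_square)
  finally have "((\<lambda>y. Re (disc_q (complex_of_real (exp (- 2 * pi * y))))) has_vector_derivative
      Re (of_real (disc_im y * (12 / pi * sinh_sum y - 2 * pi)))) (at y)"
    by (rule bounded_linear.has_vector_derivative[OF bounded_linear_Re])
  then show ?thesis
    by (simp add: has_real_derivative_iff_has_vector_derivative disc_im_def[abs_def])
qed

lemma disc_im_inversion:
  assumes y: "y > 0"
  shows "disc_im (1 / y) = y ^ 12 * disc_im y"
proof -
  define f where "f = (\<lambda>x. disc_im (1 / x) / (x ^ 12 * disc_im x))"
  have "(f has_real_derivative 0) (at x within {0<..})" if "x \<in> {0<..}" for x
  proof -
    have x: "x > 0" using that by simp
    define L where "L = (\<lambda>x. 12 / pi * sinh_sum x - 2 * pi)"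
    have pos: "disc_im x > 0" "disc_im (1 / x) > 0" using x by (simp_all add: disc_im_pos)
    have D1: "((\<lambda>x. disc_im (1 / x)) has_real_derivative disc_im (1 / x) * L (1 / x) * (- 1 / x\<^sup>2)) (at x)"
    proof -
      have "((\<lambda>x. 1 / x) has_real_derivative - 1 / x\<^sup>2) (at x)"
        using x by (auto simp: power2_eq_square intro!: derivative_eq_intros)
      moreover have "(disc_im has_real_derivative disc_im (1 / x) * L (1 / x)) (at (1 / x))"
        unfolding L_def using x by (intro disc_im_deriv) simp
      ultimately show ?thesis by (rule DERIV_chain2[where f = disc_im and g = "\<lambda>x. 1 / x", rotated])
    qed
    have D2: "((\<lambda>x. x ^ 12 * disc_im x) has_real_derivative x ^ 12 * disc_im x * (12 / x + L x)) (at x)"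
    proof -
      have "x * c * d * (12 / x + l) = 12 * c * d + d * l * (x * c)" for c d l
        using x by (simp add: field_simps)
      moreover have "x ^ 12 = x * x ^ 11" using power_Suc[of x 11] by simp
      ultimately have eq: "x ^ 12 * disc_im x * (12 / x + L x) = 12 * x ^ 11 * disc_im x + disc_im x * L x * x ^ 12"
        by (simp only:)
      have "((\<lambda>x. x ^ 12) has_real_derivative 12 * x ^ 11) (at x)"
        using DERIV_pow[of 12 x] by simp
      then have "((\<lambda>x. x ^ 12 * disc_im x) has_real_derivative
          12 * x ^ 11 * disc_im x + disc_im x * L x * x ^ 12) (at x)"
        unfolding L_def by (rule DERIV_mult[OF _ disc_im_deriv[OF x]])
      then show ?thesis unfolding eq .
    qed
    have "L (1 / x) * (- 1 / x\<^sup>2) = 12 / x + L x"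
    proof -
      have "L (1 / x) + x\<^sup>2 * L x = 12 / pi * (sinh_sum (1 / x) + x\<^sup>2 * sinh_sum x) - 2 * pi - 2 * pi * x\<^sup>2"
        by (simp add: L_def algebra_simps)
      also have "\<dots> = - 12 * x"
        unfolding sinh_sum_inversion(2)[OF x] by (simp add: field_simps power2_eq_square)
      finally have e: "L (1 / x) = - 12 * x - x\<^sup>2 * L x" by simp
      show ?thesis unfolding e using x by (simp add: field_simps power2_eq_square)
    qed
    then have D1': "((\<lambda>x. disc_im (1 / x)) has_real_derivative disc_im (1 / x) * (12 / x + L x)) (at x)"
      using D1 by (metis mult.assoc)
    have "x ^ 12 * disc_im x \<noteq> 0" using x pos by simp
    from DERIV_divide[OF D1' D2 this] have "(f has_real_derivative 0) (at x)"
      unfolding f_def by (simp add: mult_ac)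
    then show ?thesis by (rule has_field_derivative_at_within)
  qed
  then obtain c where c: "\<And>x. x > 0 \<Longrightarrow> f x = c"
    using has_field_derivative_zero_constant[of "{0<..}" f] by auto
  have "f 1 = 1" using disc_im_pos[of 1] by (simp add: f_def)
  then have "f y = 1" using c[of 1] c[OF y] by simp
  then show ?thesis
    using disc_im_pos[OF y] y by (simp add: f_def)
qed

lemma power_le_fact_mult_exp:
  fixes x :: real
  assumes "x \<ge> 0"
  shows "x ^ n \<le> fact n * exp x"
proof -
  have "(\<Sum>k\<in>{n}. x ^ k /\<^sub>R fact k) \<le> (\<Sum>k. x ^ k /\<^sub>R fact k)"
    using assms by (intro sum_le_suminf summable_exp_generic) auto
  then show ?thesis
    by (simp add: exp_def field_simps)
qed

definition disc :: "complex \<Rightarrow> complex" where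
  "disc z = disc_q (exp (2 * pi * \<i> * z))"

lemma norm_nome: "norm (exp (2 * complex_of_real pi * \<i> * z)) = exp (- 2 * pi * Im z)"
  by (simp add: norm_exp_eq_Re)

lemma disc_ii_times: "y > 0 \<Longrightarrow> disc (\<i> * of_real y) = of_real (disc_im y)"
proof -
  have "2 * complex_of_real pi * \<i> * (\<i> * of_real y) = of_real (- 2 * pi * y)"
    by (simp add: algebra_simps)
  then have "exp (2 * complex_of_real pi * \<i> * (\<i> * of_real y)) = of_real (exp (- 2 * pi * y))"
    by (simp only: exp_of_real)
  then show "y > 0 \<Longrightarrow> disc (\<i> * of_real y) = of_real (disc_im y)"
    by (simp add: disc_def of_real_disc_im)
qed

lemma holomorphic_disc: "disc holomorphic_on {z. Im z > 0}"
proof -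
  have "(disc_q \<circ> (\<lambda>z. exp (2 * pi * \<i> * z))) holomorphic_on {z. Im z > 0}"
    by (rule holomorphic_on_compose_gen[OF _ holomorphic_disc_q])
      (auto intro!: holomorphic_intros simp: norm_nome)
  then show ?thesis by (simp add: disc_def[abs_def] o_def)
qed

lemma disc_plus_of_int: "disc (z + of_int n) = disc z"
proof -
  have "exp (2 * complex_of_real pi * \<i> * (z + of_int n)) =
      exp (2 * complex_of_real pi * \<i> * z) * exp (2 * complex_of_real pi * \<i> * of_int n)"
    by (simp add: exp_add[symmetric] distrib_left)
  also have "exp (2 * complex_of_real pi * \<i> * of_int n) = 1"
    using exp_integer_2pi[of "of_int n"] by (simp add: mult_ac)
  finally show ?thesis by (simp add: disc_def)
qed

lemma Im_minus_inverse: "Im (- 1 / z) = Im z / (norm z)\<^sup>2"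
  by (simp add: Im_divide cmod_power2)

lemma disc_minus_inverse:
  assumes "Im z > 0"
  shows "disc (- 1 / z) = z ^ 12 * disc z"
proof -
  define H where "H = {z. Im z > 0}"
  define f where "f = (\<lambda>z. disc (- 1 / z) - z ^ 12 * disc z)"
  have H: "open H" "connected H"
    unfolding H_def by (auto intro: open_halfspace_Im_gt convex_connected convex_halfspace_Im_gt)
  have holH: "disc holomorphic_on H" unfolding H_def by (rule holomorphic_disc)
  have "(\<lambda>z. - 1 / z) ` H \<subseteq> H"
  proof safe
    fix z assume "z \<in> H"
    then have "Im z > 0" "z \<noteq> 0" by (auto simp: H_def)
    then have "Im (- 1 / z) > 0" unfolding Im_minus_inverse by simp
    then show "- 1 / z \<in> H" by (simp add: H_def)
  qed
  moreover have "(\<lambda>z. - 1 / z) holomorphic_on H"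
    by (intro holomorphic_intros) (auto simp: H_def)
  ultimately have "(disc \<circ> (\<lambda>z. - 1 / z)) holomorphic_on H"
    by (intro holomorphic_on_compose_gen[OF _ holH])
  then have hol: "f holomorphic_on H"
    unfolding f_def o_def by (intro holomorphic_intros holH)
  have zero: "f w = 0" if "w \<in> (\<lambda>y. \<i> * of_real y) ` {0<..}" for w
  proof -
    from that obtain y where "w = \<i> * of_real y" "y \<in> {0<..}" by (rule imageE)
    then have y: "y > 0" "w = \<i> * of_real y" by simp_all
    have "- 1 / w = \<i> * of_real (1 / y)"
      using y by (simp add: field_simps)
    then have "disc (- 1 / w) = of_real (disc_im (1 / y))"
      using y by (simp only: disc_ii_times zero_less_divide_1_iff)
    moreover have "w ^ 12 = of_real (y ^ 12)"
    proof -
      have "\<i> ^ 12 = (\<i>\<^sup>2) ^ 6" by (simp only: power_mult[symmetric]) simp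
      then have "\<i> ^ 12 = 1" by simp
      then show ?thesis unfolding y(2) power_mult_distrib by simp
    qed
    ultimately show ?thesis
      using y by (simp add: f_def disc_ii_times disc_im_inversion)
  qed
  have lim: "\<i> islimpt (\<lambda>y. \<i> * of_real y) ` {0<..}"
    unfolding islimpt_approachable
  proof (intro allI impI)
    fix e :: real assume e: "e > 0"
    have "dist (\<i> * of_real (1 + e / 2)) \<i> = norm (\<i> * of_real (e / 2))"
      by (simp add: dist_norm algebra_simps)
    also have "\<dots> < e" using e by (simp only: norm_mult norm_ii norm_of_real)
    finally show "\<exists>x'\<in>(\<lambda>y. \<i> * of_real y) ` {0<..}. x' \<noteq> \<i> \<and> dist x' \<i> < e"
      using e by (intro bexI[of _ "\<i> * of_real (1 + e / 2)"]) (auto simp: complex_eq_iff)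
  qed
  have "f z = 0"
    by (rule analytic_continuation[OF hol H _ _ lim zero]) (use assms in \<open>auto simp: H_def\<close>)
  then show ?thesis by (simp add: f_def)
qed

lemma disc_q_bound:
  assumes "r < 1"
  obtains K where "K > 0" "\<And>q. norm q \<le> r \<Longrightarrow> norm (disc_q q) \<le> K * norm q"
proof -
  have "continuous_on (cball 0 r) (\<lambda>q. euler_prod q ^ 24)"
    using assms by (intro continuous_intros holomorphic_on_imp_continuous_on
        holomorphic_on_subset[OF holomorphic_euler_prod]) auto
  then have "bounded ((\<lambda>q. euler_prod q ^ 24) ` cball 0 r)"
    by (intro compact_imp_bounded compact_continuous_image) auto
  then obtain K where K: "K > 0" "\<And>q. norm q \<le> r \<Longrightarrow> norm (euler_prod q ^ 24) \<le> K"
    unfolding bounded_pos by auto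
  show ?thesis
  proof (rule that[OF K(1)])
    fix q :: complex assume "norm q \<le> r"
    then show "norm (disc_q q) \<le> K * norm q"
      using mult_left_mono[OF K(2), of q "norm q"] by (simp add: disc_q_def norm_mult mult.commute)
  qed
qed

lemma disc_bound_far:
  obtains C where "\<And>z. Im z \<ge> 1 / 2 \<Longrightarrow> norm (disc z) * Im z ^ 6 \<le> C"
proof -
  obtain K where K: "K > 0" "\<And>q. norm q \<le> exp (- pi) \<Longrightarrow> norm (disc_q q) \<le> K * norm q"
    using disc_q_bound[of "exp (- pi)"] by auto
  have "norm (disc z) * Im z ^ 6 \<le> K * fact 6" if z: "Im z \<ge> 1 / 2" for z
  proof -
    have "exp (- 2 * pi * Im z) \<le> exp (- pi)"
      using z mult_left_mono[of "1 / 2" "Im z" pi] by simp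
    then have "norm (disc z) \<le> K * exp (- 2 * pi * Im z)"
      using K(2)[of "exp (2 * pi * \<i> * z)"] unfolding disc_def norm_nome by simp
    moreover have "Im z ^ 6 \<le> fact 6 * exp (2 * pi * Im z)"
    proof (rule order_trans[OF _ power_le_fact_mult_exp])
      have "1 * Im z \<le> 2 * pi * Im z"
        using z pi_ge_two by (intro mult_right_mono) auto
      then show "Im z ^ 6 \<le> (2 * pi * Im z) ^ 6"
        using z by (intro power_mono) auto
    qed (use z in auto)
    ultimately have "norm (disc z) * Im z ^ 6 \<le> (K * exp (- 2 * pi * Im z)) * (fact 6 * exp (2 * pi * Im z))"
      using K(1) z by (intro mult_mono) auto
    also have "\<dots> = K * fact 6"
      by (simp add: exp_minus)
    finally show ?thesis .
  qed
  then show ?thesis by (rule that)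
qed

text \<open>
  The function \<open>norm (disc z) * Im z ^ 6\<close> is invariant under translations and inversion. A
  translation to \<open>\<bar>Re z\<bar> \<le> 1/2\<close> followed by an inversion at least doubles imaginary parts below 1/2.
\<close>

lemma disc_bound:
  obtains C where "\<And>z. Im z > 0 \<Longrightarrow> norm (disc z) * Im z ^ 6 \<le> C"
proof -
  obtain C where C: "\<And>z. Im z \<ge> 1 / 2 \<Longrightarrow> norm (disc z) * Im z ^ 6 \<le> C"
    by (rule disc_bound_far) blast
  have bound: "norm (disc z) * Im z ^ 6 \<le> C" if "Im z \<ge> 1 / 2 / 2 ^ n" for z n
    using that
  proof (induction n arbitrary: z)
    case 0
    then show ?case using C by simp
  next
    case (Suc n)
    show ?case
    proof (cases "Im z \<ge> 1 / 2")
      case False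
      have pos: "Im z > 0" using Suc.prems by (auto intro: less_le_trans[rotated])
      define w where "w = z + of_int (- round (Re z))"
      have w: "Im w = Im z" "disc w = disc z" "\<bar>Re w\<bar> \<le> 1 / 2"
        using of_int_round_abs_le[of "Re z"] disc_plus_of_int[of z "- round (Re z)"]
        by (auto simp: w_def abs_minus_commute)
      have "w \<noteq> 0" using w pos by auto
      then have nw: "norm w > 0" by simp
      have "(Re w)\<^sup>2 \<le> (1 / 2)\<^sup>2" "(Im w)\<^sup>2 \<le> (1 / 2)\<^sup>2"
        using w False pos by (intro abs_le_square_iff[THEN iffD1]; simp)+
      then have "(norm w)\<^sup>2 \<le> 1 / 2"
        unfolding cmod_power2 by (simp add: power2_eq_square)
      then have "2 * Im z \<le> Im z / (norm w)\<^sup>2"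
        using pos nw by (simp add: field_simps)
      then have Im: "2 * Im z \<le> Im (- 1 / w)"
        by (simp only: Im_minus_inverse w)
      have "norm (disc (- 1 / w)) * Im (- 1 / w) ^ 6 \<le> C"
      proof (rule Suc.IH)
        have "1 / 2 / 2 ^ n = 2 * (1 / 2 / 2 ^ Suc n :: real)" by simp
        also have "\<dots> \<le> 2 * Im z" using Suc.prems by (intro mult_left_mono) auto
        finally show "1 / 2 / 2 ^ n \<le> Im (- 1 / w)" using Im by linarith
      qed
      moreover have "norm (disc (- 1 / w)) * Im (- 1 / w) ^ 6 = norm (disc z) * Im z ^ 6"
      proof -
        have "disc (- 1 / w) = w ^ 12 * disc z"
          using disc_minus_inverse[of w] w pos by simp
        moreover have "r ^ 12 * d * (y / r\<^sup>2) ^ 6 = d * y ^ 6" if "r > 0" for r d y :: real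
          using that by (simp add: power_divide power_mult[symmetric])
        ultimately show ?thesis
          using nw by (simp only: Im_minus_inverse w(1) norm_mult norm_power)
      qed
      ultimately show ?thesis by simp
    qed (rule C)
  qed
  have "norm (disc z) * Im z ^ 6 \<le> C" if z: "Im z > 0" for z
  proof -
    obtain n where "(1 / 2) ^ n < Im z"
      using real_arch_pow_inv[OF z, of "1 / 2"] by auto
    then show ?thesis
      by (intro bound[of n]) (simp add: power_one_over field_simps)
  qed
  then show ?thesis by (rule that)
qed

section \<open>The Ramanujan tau function\<close>

abbreviation eta_factor :: "nat \<Rightarrow> 'a::comm_ring_1 fps" where
  "eta_factor n \<equiv> (1 - fps_X ^ Suc n) ^ 24"

lemma fps_nth_mult_eta_factor:
  fixes F :: "'a::comm_ring_1 fps"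
  assumes "m \<le> n"
  shows "fps_nth (F * eta_factor n) m = fps_nth F m"
proof -
  define x where "x = (fps_X ^ Suc n :: 'a fps)"
  have "(1 - x) ^ 24 - 1 = (1 - x - 1) * (\<Sum>i<24. (1 - x) ^ i)"
    by (rule power_diff_1_eq)
  then have "(1 - x) ^ 24 = 1 - x * (\<Sum>i<24. (1 - x) ^ i)"
    by (simp add: algebra_simps)
  then have "F * (1 - x) ^ 24 = F - x * ((\<Sum>i<24. (1 - x) ^ i) * F)"
    by (simp only:) (simp add: algebra_simps)
  moreover have "fps_nth (x * G) m = 0" for G
    unfolding x_def fps_X_power_mult_nth using assms by simp
  ultimately show ?thesis
    unfolding x_def[symmetric] by simp
qed

lemma fps_nth_prod_eta_factor:
  fixes N :: nat
  assumes "m \<le> N"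
  shows "fps_nth (\<Prod>i<N. eta_factor i) m = (fps_nth (\<Prod>i<m. eta_factor i) m :: 'a::comm_ring_1)"
  using assms
proof (induction N rule: dec_induct)
  case (step N)
  then show ?case by (simp add: fps_nth_mult_eta_factor del: power_Suc)
qed auto

lemma prodinf_eta_factor_nth:
  "fps_nth (\<Prod>i. eta_factor i :: int fps) m = fps_nth (\<Prod>i<m. eta_factor i) m"
proof -
  define F :: "int fps" where "F = Abs_fps (\<lambda>m. fps_nth (\<Prod>i<m. eta_factor i) m)"
  have "(\<lambda>n. \<Prod>i\<le>n. eta_factor i) \<longlonglongrightarrow> F"
  proof (rule tendsto_fpsI)
    fix m
    show "\<forall>\<^sub>F n in sequentially. fps_nth (\<Prod>i\<le>n. eta_factor i) m = fps_nth F m"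
      using eventually_ge_at_top[of m]
    proof eventually_elim
      case (elim n)
      then show ?case
        using fps_nth_prod_eta_factor[of m "Suc n"] by (simp only: F_def fps_nth_Abs_fps lessThan_Suc_atMost) simp
    qed
  qed
  moreover have "F \<noteq> 0"
  proof -
    have "fps_nth F 0 = 1" by (simp add: F_def)
    then show ?thesis by auto
  qed
  ultimately have "(\<lambda>i. eta_factor i :: int fps) has_prod F"
    by (simp add: has_prod_def raw_has_prod_def del: power_Suc)
  then have "(\<Prod>i. eta_factor i :: int fps) = F"
    by (rule has_prod_unique[symmetric])
  then show ?thesis by (simp add: F_def)
qed

lemma ramanujan_tau_eq:
  assumes "m \<le> N"
  shows "ramanujan_tau m = fps_nth (fps_X * (\<Prod>i<N. eta_factor i)) m"
proof (cases m)
  case (Suc k)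
  have "fps_nth (\<Prod>i. eta_factor i :: int fps) k = fps_nth (\<Prod>i<N. eta_factor i) k"
    unfolding prodinf_eta_factor_nth by (rule fps_nth_prod_eta_factor[symmetric]) (use assms Suc in simp)
  then show ?thesis by (simp add: ramanujan_tau_def Suc del: power_Suc)
qed (simp add: ramanujan_tau_def)

definition fps_of_int_coeffs :: "int fps \<Rightarrow> complex fps" where
  "fps_of_int_coeffs F = Abs_fps (\<lambda>n. of_int (fps_nth F n))"

lemma fps_of_int_coeffs_hom:
  "fps_of_int_coeffs 1 = 1" "fps_of_int_coeffs fps_X = fps_X"
  "fps_of_int_coeffs (F * G) = fps_of_int_coeffs F * fps_of_int_coeffs G"
  "fps_of_int_coeffs (F - G) = fps_of_int_coeffs F - fps_of_int_coeffs G"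
  by (auto simp: fps_of_int_coeffs_def fps_eq_iff fps_mult_nth)

lemma fps_of_int_coeffs_power: "fps_of_int_coeffs (F ^ n) = fps_of_int_coeffs F ^ n"
  by (induction n) (simp_all add: fps_of_int_coeffs_hom)

lemma fps_of_int_coeffs_prod: "fps_of_int_coeffs (\<Prod>i<n. F i) = (\<Prod>i<n. fps_of_int_coeffs (F i))"
  for n :: nat
  by (induction n) (simp_all add: fps_of_int_coeffs_hom)

lemma disc_q_coeff: "(deriv ^^ m) disc_q 0 / fact m = of_int (ramanujan_tau m)"
proof -
  define D where "D = (\<lambda>N q. q * (\<Prod>n<N. 1 - q ^ Suc n) ^ 24 :: complex)"
  have coeff: "(deriv ^^ m) (D N) 0 / fact m = of_int (ramanujan_tau m)" if "m \<le> N" for N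
  proof -
    have "D N has_fps_expansion fps_X * (\<Prod>n<N. 1 - fps_X ^ Suc n) ^ 24"
      unfolding D_def by (intro fps_expansion_intros has_fps_expansion_power)
    moreover have "fps_X * (\<Prod>n<N. 1 - fps_X ^ Suc n) ^ 24 = fps_of_int_coeffs (fps_X * (\<Prod>i<N. eta_factor i))"
      by (simp only: fps_of_int_coeffs_hom fps_of_int_coeffs_power fps_of_int_coeffs_prod prod_power_distrib)
    ultimately have "D N has_fps_expansion fps_of_int_coeffs (fps_X * (\<Prod>i<N. eta_factor i))"
      by simp
    from fps_nth_fps_expansion[OF this, of m] show ?thesis
      unfolding ramanujan_tau_eq[OF that] by (simp add: fps_of_int_coeffs_def)
  qed
  have "uniform_limit (cball 0 (1 / 2)) D disc_q sequentially"
  proof -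
    have lim: "uniform_limit (cball 0 (1 / 2)) (\<lambda>N q. \<Prod>n<N. 1 - q ^ Suc n) euler_prod sequentially"
      by (rule uniform_limit_euler_prod) simp
    have cont: "continuous_on (cball 0 (1 / 2)) euler_prod"
      by (intro holomorphic_on_imp_continuous_on holomorphic_on_subset[OF holomorphic_euler_prod]) auto
    have "bounded ((\<lambda>q. euler_prod q ^ k) ` cball 0 (1 / 2))" for k
      by (intro compact_imp_bounded compact_continuous_image continuous_intros cont compact_cball)
    then have pow: "uniform_limit (cball 0 (1 / 2)) (\<lambda>N q. (\<Prod>n<N. 1 - q ^ Suc n) ^ k) (\<lambda>q. euler_prod q ^ k) sequentially" for k
    proof (induction k)
      case (Suc k)
      show ?case
        unfolding power_Suc[of _ k]
        by (rule uniform_lim_mult[OF lim Suc.IH[OF Suc.prems]]) (use Suc.prems[of 1] Suc.prems[of k] in simp_all)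
    qed (simp add: uniform_limit_const)
    have "bounded ((\<lambda>q. euler_prod q ^ 24) ` cball 0 (1 / 2))"
      by (intro compact_imp_bounded compact_continuous_image continuous_intros cont compact_cball)
    moreover have "bounded ((\<lambda>q::complex. q) ` cball 0 (1 / 2))" by simp
    ultimately show ?thesis
      unfolding D_def disc_q_def by (intro uniform_lim_mult uniform_limit_const pow)
  qed
  then have "uniform_limit (ball 0 (1 / 2)) D disc_q sequentially"
    by (rule uniform_limit_on_subset) auto
  then have "(\<lambda>N. (deriv ^^ m) (D N) 0) \<longlonglongrightarrow> (deriv ^^ m) disc_q 0"
    by (rule higher_deriv_complex_uniform_limit) (auto simp: D_def intro!: holomorphic_intros always_eventually)
  then have "(\<lambda>N. (deriv ^^ m) (D N) 0 / fact m) \<longlonglongrightarrow> (deriv ^^ m) disc_q 0 / fact m"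
    by (intro tendsto_intros) auto
  moreover have "\<forall>\<^sub>F N in sequentially. (deriv ^^ m) (D N) 0 / fact m = of_int (ramanujan_tau m)"
    using eventually_ge_at_top[of m] by eventually_elim (rule coeff)
  then have "(\<lambda>N. (deriv ^^ m) (D N) 0 / fact m) \<longlonglongrightarrow> of_int (ramanujan_tau m)"
    by (rule tendsto_eventually)
  ultimately show ?thesis by (rule LIMSEQ_unique)
qed

lemma ramanujan_tau_sums:
  assumes "norm q < 1"
  shows "(\<lambda>n. of_int (ramanujan_tau n) * q ^ n) sums disc_q q"
  using holomorphic_power_series[OF holomorphic_disc_q, of q] assms by (simp add: disc_q_coeff)

lemma ramanujan_tau_0 [simp]: "ramanujan_tau 0 = 0"
  by (simp add: ramanujan_tau_def)

section \<open>Mean square of the coefficients\<close>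

lemma sum_cis_multiples:
  fixes m n K :: nat
  assumes "m < K" "n < K"
  shows "(\<Sum>j<K. cis (2 * pi * real j * real n / K) * cnj (cis (2 * pi * real j * real m / K))) = (if m = n then of_nat K else 0)"
proof -
  define z where "z = cis (2 * pi * (real n - real m) / K)"
  have "(\<Sum>j<K. cis (2 * pi * real j * real n / K) * cnj (cis (2 * pi * real j * real m / K))) = (\<Sum>j<K. z ^ j)"
    by (intro sum.cong) (simp_all add: z_def cis_cnj cis_mult Complex.DeMoivre diff_divide_distrib algebra_simps)
  also have "\<dots> = (if m = n then of_nat K else 0)"
  proof (cases "m = n")
    case False
    have "z ^ K = cis (2 * pi * (real n - real m))"
      using assms by (simp add: z_def Complex.DeMoivre)
    also have "\<dots> = 1"
      using cis_multiple_2pi[of "real n - real m"] by simp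
    finally have "z ^ K = 1" .
    moreover have "z \<noteq> 1"
    proof
      assume "z = 1"
      then have "cos (2 * pi * (real n - real m) / K) = 1"
        by (simp add: z_def complex_eq_iff)
      then obtain k :: int where "2 * pi * (real n - real m) / K = of_int k * 2 * pi"
        unfolding cos_one_2pi_int by blast
      then have "2 * pi * ((real n - real m) / K - of_int k) = 0" by (simp add: algebra_simps)
      then have "(real n - real m) / K = of_int k" by simp
      then have "real n - real m = of_int k * K" using assms by (simp add: field_simps)
      then have "of_int (int n - int m) = (of_int (k * int K) :: real)" by simp
      then have "int n - int m = k * int K" by (simp only: of_int_eq_iff)
      then have "int K dvd int n - int m" by simp
      moreover have "\<bar>int n - int m\<bar> < int K" "int n - int m \<noteq> 0" using assms False by auto
      ultimately show False
        using dvd_imp_le_int[of "int n - int m" "int K"] by simp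
    qed
    ultimately show ?thesis using False by (simp add: geometric_sum)
  qed (simp add: z_def)
  finally show ?thesis .
qed

lemma discrete_parseval:
  fixes a :: "nat \<Rightarrow> complex"
  shows "(\<Sum>j<K. (norm (\<Sum>n<K. a n * cis (2 * pi * real j / K) ^ n))\<^sup>2) = K * (\<Sum>n<K. (norm (a n))\<^sup>2)"
proof -
  have "complex_of_real (\<Sum>j<K. (norm (\<Sum>n<K. a n * cis (2 * pi * real j / K) ^ n))\<^sup>2) =
      (\<Sum>j<K. \<Sum>n<K. \<Sum>m<K. a n * cnj (a m) *
        (cis (2 * pi * real j * real n / K) * cnj (cis (2 * pi * real j * real m / K))))"
    by (simp only: of_real_sum complex_norm_square cnj_sum sum_product complex_cnj_mult complex_cnj_power
        Complex.DeMoivre)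
      (simp add: mult_ac cis_cnj Complex.DeMoivre)
  also have "\<dots> = (\<Sum>n<K. \<Sum>m<K. a n * cnj (a m) *
        (\<Sum>j<K. cis (2 * pi * real j * real n / K) * cnj (cis (2 * pi * real j * real m / K))))"
  proof -
    have "(\<Sum>j<K. \<Sum>n<K. \<Sum>m<K. g j n m) = (\<Sum>n<K. \<Sum>m<K. \<Sum>j<K. g j n m)" for g :: "nat \<Rightarrow> nat \<Rightarrow> nat \<Rightarrow> complex"
    proof -
      have "(\<Sum>j<K. \<Sum>n<K. \<Sum>m<K. g j n m) = (\<Sum>n<K. \<Sum>j<K. \<Sum>m<K. g j n m)"
        by (rule sum.swap)
      also have "\<dots> = (\<Sum>n<K. \<Sum>m<K. \<Sum>j<K. g j n m)"
        by (intro sum.cong refl sum.swap)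
      finally show ?thesis .
    qed
    then show ?thesis by (simp only: sum_distrib_left)
  qed
  also have "\<dots> = (\<Sum>n<K. \<Sum>m<K. a n * cnj (a m) * (if m = n then of_nat K else 0))"
    by (intro sum.cong refl) (simp add: sum_cis_multiples)
  also have "\<dots> = (\<Sum>n<K. of_nat K * (a n * cnj (a n)))"
    by (intro sum.cong refl) (simp add: if_distrib[of "\<lambda>x. _ * x"] sum.delta mult_ac cong: if_cong)
  also have "\<dots> = complex_of_real (K * (\<Sum>n<K. (norm (a n))\<^sup>2))"
    by (simp add: complex_norm_square sum_distrib_left flip: of_real_power)
  finally show ?thesis by (simp only: of_real_eq_iff)
qed

lemma mean_square_bound:
  fixes a :: "nat \<Rightarrow> complex"
  assumes summable: "summable (\<lambda>n. norm (a n) * r ^ n)" and r: "r \<ge> 0"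
    and f: "\<And>q. norm q = r \<Longrightarrow> (\<lambda>n. a n * q ^ n) sums f q" "\<And>q. norm q = r \<Longrightarrow> norm (f q) \<le> B"
  shows "(\<Sum>n<N. (norm (a n) * r ^ n)\<^sup>2) \<le> B\<^sup>2"
proof -
  define t where "t = (\<lambda>K. (\<Sum>n. norm (a (n + K)) * r ^ (n + K)))"
  have t0: "t \<longlonglongrightarrow> 0"
    unfolding t_def using suminf_exist_split2[OF summable] .
  have main: "(\<Sum>n<K. (norm (a n) * r ^ n)\<^sup>2) \<le> (B + t K)\<^sup>2" if "K > 0" for K
  proof -
    have p: "norm (\<Sum>n<K. a n * q ^ n) \<le> B + t K" if q: "norm q = r" for q
    proof -
      have s: "summable (\<lambda>n. a n * q ^ n)" using f(1)[OF q] sums_summable by blast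
      have sK: "summable (\<lambda>n. norm (a (n + K)) * r ^ (n + K))"
        by (rule summable_ignore_initial_segment[OF summable])
      have "f q = (\<Sum>n. a (n + K) * q ^ (n + K)) + (\<Sum>n<K. a n * q ^ n)"
        using f(1)[OF q] suminf_split_initial_segment[OF s, of K] by (simp add: sums_iff)
      then have "(\<Sum>n<K. a n * q ^ n) = f q - (\<Sum>n. a (n + K) * q ^ (n + K))" by simp
      also have "norm \<dots> \<le> norm (f q) + norm (\<Sum>n. a (n + K) * q ^ (n + K))"
        by (rule norm_triangle_ineq4)
      also have "norm (\<Sum>n. a (n + K) * q ^ (n + K)) \<le> t K"
        unfolding t_def using sK q by (intro order_trans[OF summable_norm]) (auto simp: norm_mult norm_power)
      finally show ?thesis using f(2)[OF q] by simp
    qed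
    have "K * (\<Sum>n<K. (norm (a n) * r ^ n)\<^sup>2) =
        (\<Sum>j<K. (norm (\<Sum>n<K. a n * (of_real r * cis (2 * pi * real j / K)) ^ n))\<^sup>2)"
      using discrete_parseval[of "\<lambda>n. a n * of_real r ^ n" K] r
      by (simp add: norm_mult norm_power power_mult_distrib mult.assoc)
    also have "\<dots> \<le> (\<Sum>j<K. (B + t K)\<^sup>2)"
      using r by (intro sum_mono power_mono p) (auto simp: norm_mult)
    finally show ?thesis using that by simp
  qed
  have "(\<Sum>n<N. (norm (a n) * r ^ n)\<^sup>2) \<le> (B + t K)\<^sup>2" if "K \<ge> Suc N" for K
    using that by (intro order_trans[OF sum_mono2 main]) auto
  then have "\<forall>\<^sub>F K in sequentially. (\<Sum>n<N. (norm (a n) * r ^ n)\<^sup>2) \<le> (B + t K)\<^sup>2"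
    unfolding eventually_sequentially by blast
  moreover have "(\<lambda>K. (B + t K)\<^sup>2) \<longlonglongrightarrow> (B + 0)\<^sup>2"
    by (intro tendsto_intros t0)
  ultimately show ?thesis
    using tendsto_lowerbound by fastforce
qed

lemma disc_q_circle_bound:
  obtains C where "\<And>X q. X > 0 \<Longrightarrow> norm q = exp (- 2 * pi / X) \<Longrightarrow> norm (disc_q q) \<le> C * X ^ 6"
proof -
  obtain C where C: "\<And>z. Im z > 0 \<Longrightarrow> norm (disc z) * Im z ^ 6 \<le> C"
    by (rule disc_bound) blast
  have "norm (disc_q q) \<le> C * X ^ 6" if X: "X > 0" and q: "norm q = exp (- 2 * pi / X)" for X q
  proof -
    define z where "z = Ln q / (2 * pi * \<i>)"
    have q0: "q \<noteq> 0" using q by auto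
    have "2 * complex_of_real pi * \<i> * z = Ln q" by (simp add: z_def)
    then have "exp (2 * complex_of_real pi * \<i> * z) = q" using q0 by simp
    then have "disc z = disc_q q" by (simp add: disc_def)
    moreover have "z = - (\<i> * Ln q) / of_real (2 * pi)"
      by (simp add: z_def field_simps)
    then have "Im z = - Re (Ln q) / (2 * pi)"
      by (simp only: Im_divide_of_real) simp
    then have "Im z = 1 / X"
      using q0 q X by simp
    ultimately have "norm (disc_q q) * (1 / X) ^ 6 \<le> C"
      using C[of z] X by simp
    then show ?thesis using X by (simp add: power_one_over field_simps)
  qed
  then show ?thesis by (rule that)
qed

lemma ramanujan_tau_summable:
  assumes "0 \<le> r" "r < 1"
  shows "summable (\<lambda>n. norm (of_int (ramanujan_tau n) :: complex) * r ^ n)"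
proof -
  define s where "s = (1 + r) / 2"
  have s: "0 \<le> s" "s < 1" using assms by (auto simp: s_def)
  have "summable (\<lambda>n. of_int (ramanujan_tau n) * complex_of_real s ^ n)"
    by (rule sums_summable[OF ramanujan_tau_sums]) (use s in simp)
  then have "summable (\<lambda>n. norm (of_int (ramanujan_tau n) * complex_of_real r ^ n))"
    by (rule powser_insidea) (use assms in \<open>simp add: s_def del: of_real_add of_real_divide\<close>)
  then show ?thesis using assms by (simp add: norm_mult norm_power)
qed

lemma ramanujan_tau_mean_square:
  obtains C where "\<And>X F. X \<ge> 1 \<Longrightarrow> finite F \<Longrightarrow> (\<And>n. n \<in> F \<Longrightarrow> real n \<le> X) \<Longrightarrow>
    (\<Sum>n\<in>F. (real_of_int (ramanujan_tau n))\<^sup>2) \<le> C * X powr 12"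
proof -
  obtain C where C: "\<And>X q. X > 0 \<Longrightarrow> norm q = exp (- 2 * pi / X) \<Longrightarrow> norm (disc_q q) \<le> C * X ^ 6"
    by (rule disc_q_circle_bound) blast
  have "(\<Sum>n\<in>F. (real_of_int (ramanujan_tau n))\<^sup>2) \<le> (C\<^sup>2 * exp (4 * pi)) * X powr 12"
    if X: "X \<ge> 1" and F: "finite F" "\<And>n. n \<in> F \<Longrightarrow> real n \<le> X" for X F
  proof -
    define r where "r = exp (- 2 * pi / X)"
    have r: "0 < r" "r < 1" using X by (simp_all add: r_def)
    define b where "b = (\<lambda>n. norm (of_int (ramanujan_tau n) :: complex) * r ^ n)"
    obtain N where N: "F \<subseteq> {..<N}"
      using finite_nat_iff_bounded[THEN iffD1, OF F(1)] by blast
    have "(\<Sum>n<N. (b n)\<^sup>2) \<le> (C * X ^ 6)\<^sup>2"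
      unfolding b_def
    proof (rule mean_square_bound[where f = disc_q])
      show "summable (\<lambda>n. norm (of_int (ramanujan_tau n) :: complex) * r ^ n)"
        using r by (intro ramanujan_tau_summable) auto
    next
      fix q :: complex assume q: "norm q = r"
      then show "(\<lambda>n. of_int (ramanujan_tau n) * q ^ n) sums disc_q q"
        using r by (intro ramanujan_tau_sums) simp
      show "norm (disc_q q) \<le> C * X ^ 6"
        using X q by (intro C) (simp_all add: r_def)
    qed (use r in simp)
    moreover have "(\<Sum>n\<in>F. (b n)\<^sup>2) \<le> (\<Sum>n<N. (b n)\<^sup>2)"
      using N by (intro sum_mono2) auto
    ultimately have b: "(\<Sum>n\<in>F. (b n)\<^sup>2) \<le> (C * X ^ 6)\<^sup>2" by simp
    have "(\<Sum>n\<in>F. (real_of_int (ramanujan_tau n))\<^sup>2) \<le> (\<Sum>n\<in>F. exp (4 * pi) * (b n)\<^sup>2)"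
    proof (rule sum_mono)
      fix n assume "n \<in> F"
      then have "real n / X \<le> 1" using F(2) X by (simp add: field_simps)
      then have "0 \<le> 4 * pi * (1 - real n / X)" by simp
      then have "1 \<le> exp (4 * pi * (1 - real n / X))" by (simp only: one_le_exp_iff)
      also have "4 * pi * (1 - real n / X) = 4 * pi + real (2 * n) * (- 2 * pi / X)"
        by (simp add: algebra_simps)
      also have "exp \<dots> = exp (4 * pi) * r ^ (2 * n)"
        by (simp only: exp_add exp_of_nat_mult r_def)
      finally have "(real_of_int (ramanujan_tau n))\<^sup>2 * 1 \<le> (real_of_int (ramanujan_tau n))\<^sup>2 * (exp (4 * pi) * r ^ (2 * n))"
        by (intro mult_left_mono) auto
      also have "\<dots> = exp (4 * pi) * (b n)\<^sup>2"
        by (simp add: b_def power_mult_distrib power_mult[symmetric] mult_ac)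
      finally show "(real_of_int (ramanujan_tau n))\<^sup>2 \<le> exp (4 * pi) * (b n)\<^sup>2" by simp
    qed
    also have "\<dots> = exp (4 * pi) * (\<Sum>n\<in>F. (b n)\<^sup>2)"
      by (simp add: sum_distrib_left)
    also have "\<dots> \<le> exp (4 * pi) * (C * X ^ 6)\<^sup>2"
      using b by (intro mult_left_mono) auto
    also have "\<dots> = (C\<^sup>2 * exp (4 * pi)) * X powr 12"
      using X by (simp add: power_mult_distrib power_mult[symmetric] powr_numeral)
    finally show ?thesis .
  qed
  then show ?thesis by (rule that)
qed

lemma ramanujan_tau_dirichlet_summable:
  assumes \<sigma>: "\<sigma> > 13 / 2"
  shows "summable (\<lambda>l. \<bar>real_of_int (ramanujan_tau (Suc l))\<bar> * real (Suc l) powr (- \<sigma>))"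
proof -
  obtain C where C: "\<And>X F. X \<ge> 1 \<Longrightarrow> finite F \<Longrightarrow> (\<And>n. n \<in> F \<Longrightarrow> real n \<le> X) \<Longrightarrow>
    (\<Sum>n\<in>F. (real_of_int (ramanujan_tau n))\<^sup>2) \<le> C * X powr 12"
    by (rule ramanujan_tau_mean_square) blast
  define \<beta> where "\<beta> = \<sigma> + 11 / 2"
  have \<beta>: "\<beta> > 12" "\<beta> - 2 * \<sigma> < -1" using \<sigma> by (auto simp: \<beta>_def)
  have "(\<lambda>n. (real_of_int (ramanujan_tau n))\<^sup>2 * real n powr (- \<beta>)) summable_on {1..}"
  proof (rule summable_on_powr_of_counting_bound)
    show "(\<Sum>n\<in>F. (real_of_int (ramanujan_tau n))\<^sup>2) \<le> C * X powr 12"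
      if "1 \<le> X" "finite F" "\<And>n. n \<in> F \<Longrightarrow> real n \<le> X" for X F
      using that by (rule C)
  qed (use \<beta> in auto)
  also have "{1..} = range Suc"
    by (auto simp: image_iff Suc_le_eq gr0_conv_Suc)
  finally have "(\<lambda>l. (real_of_int (ramanujan_tau (Suc l)))\<^sup>2 * real (Suc l) powr (- \<beta>)) summable_on UNIV"
    by (subst (asm) summable_on_reindex) (auto simp: o_def)
  then have "summable (\<lambda>l. (real_of_int (ramanujan_tau (Suc l)))\<^sup>2 * real (Suc l) powr (- \<beta>))"
    by (rule summable_on_imp_summable)
  moreover have "summable (\<lambda>l. real (Suc l) powr (\<beta> - 2 * \<sigma>))"
    using \<beta> by (subst summable_Suc_iff[where f = "\<lambda>l. real l powr (\<beta> - 2 * \<sigma>)"]) (simp add: summable_real_powr_iff)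
  ultimately have "summable (\<lambda>l. (real_of_int (ramanujan_tau (Suc l)))\<^sup>2 * real (Suc l) powr (- \<beta>) +
      real (Suc l) powr (\<beta> - 2 * \<sigma>))"
    by (rule summable_add)
  then show ?thesis
  proof (rule summable_comparison_test'[where N = 0])
    fix l :: nat
    define t n where "t = \<bar>real_of_int (ramanujan_tau (Suc l))\<bar>" and "n = real (Suc l)"
    have n: "n > 0" and t: "t \<ge> 0" by (simp_all add: n_def t_def)
    define a b where "a = t * n powr (- \<beta> / 2)" and "b = n powr (\<beta> / 2 - \<sigma>)"
    have ab: "a \<ge> 0" "b \<ge> 0" using t by (simp_all add: a_def b_def)
    have "a * b = t * n powr (- \<sigma>)"
      by (simp add: a_def b_def powr_add[symmetric])
    moreover have "a\<^sup>2 = t\<^sup>2 * n powr (- \<beta>)" "b\<^sup>2 = n powr (\<beta> - 2 * \<sigma>)"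
      using n by (simp_all add: a_def b_def power_mult_distrib powr_power)
    moreover have "a * b \<le> a\<^sup>2 + b\<^sup>2"
      using sum_squares_bound[of a b] mult_nonneg_nonneg[OF ab] unfolding mult.assoc by linarith
    ultimately have "t * n powr (- \<sigma>) \<le> t\<^sup>2 * n powr (- \<beta>) + n powr (\<beta> - 2 * \<sigma>)"
      by simp
    then show "norm (\<bar>real_of_int (ramanujan_tau (Suc l))\<bar> * real (Suc l) powr - \<sigma>)
        \<le> (real_of_int (ramanujan_tau (Suc l)))\<^sup>2 * real (Suc l) powr - \<beta> + real (Suc l) powr (\<beta> - 2 * \<sigma>)"
      using t by (simp add: t_def n_def abs_mult)
  qed
qed

section \<open>The Mellin transform of the discriminant\<close>

lemma has_bochner_integral_Gamma_exp:
  fixes x :: complex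
  assumes x: "Re x > 0"
  shows "has_bochner_integral lborel (\<lambda>u. exp (x * of_real u - of_real (exp u))) (Gamma x)"
proof -
  define f where "f = (\<lambda>t. complex_of_real t powr (x - 1) / of_real (exp t))"
  define h where "h = (\<lambda>u. exp (x * of_real u - of_real (exp u)))"
  have "f absolutely_integrable_on {0<..}"
    using absolutely_integrable_Gamma_integral[OF x, of 1] by (simp add: f_def)
  moreover have "(f has_integral Gamma x) {0<..} \<longleftrightarrow> (f has_integral Gamma x) {0..}"
    by (rule has_integral_spike_set_eq) (auto intro: negligible_subset[of "{0}"] negligible_subset[of "{}"])
  then have "(f has_integral Gamma x) {0<..}"
    using Gamma_integral_complex[OF x] by (simp add: f_def)
  then have "integral {0<..} f = Gamma x" by (rule integral_unique)
  moreover have "range exp = {0::real<..}"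
  proof safe
    fix t :: real assume "t > 0"
    then show "t \<in> range exp" by (intro image_eqI[of _ _ "ln t"]) auto
  qed auto
  moreover have "\<bar>exp u\<bar> *\<^sub>R f (exp u) = h u" for u :: real
  proof -
    have "complex_of_real (exp u) powr (x - 1) = exp ((x - 1) * of_real u)"
      by (simp add: powr_def Ln_of_real)
    then have "\<bar>exp u\<bar> *\<^sub>R f (exp u) = exp (of_real u) * exp ((x - 1) * of_real u) / exp (of_real (exp u))"
      by (simp add: f_def scaleR_conv_of_real exp_of_real)
    also have "\<dots> = h u"
      by (simp add: h_def exp_add[symmetric] exp_diff[symmetric] algebra_simps)
    finally show ?thesis .
  qed
  ultimately have "h absolutely_integrable_on UNIV \<and> integral UNIV h = Gamma x"
    using has_absolute_integral_change_of_variables_real[of UNIV exp exp f "Gamma x"]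
    by (auto intro!: derivative_eq_intros simp: inj_on_def)
  moreover have meas: "h \<in> borel_measurable lborel"
    unfolding h_def measurable_lborel2 by (intro borel_measurable_continuous_onI continuous_intros)
  ultimately have int: "integrable lborel h" "integral UNIV h = Gamma x"
    by (auto simp: set_integrable_def integrable_completion)
  then show ?thesis
    unfolding has_bochner_integral_iff h_def[symmetric] using integral_lborel[OF int(1)] by simp
qed

lemma has_bochner_integral_Gamma_exp_scaled:
  fixes x :: complex
  assumes x: "Re x > 0" and c: "c > 0"
  shows "has_bochner_integral lborel (\<lambda>u. exp (x * of_real u - of_real (c * exp u))) (of_real c powr (- x) * Gamma x)"
proof -
  have "has_bochner_integral lborel (\<lambda>u. exp (x * of_real (ln c + 1 * u) - of_real (exp (ln c + 1 * u)))) (Gamma x /\<^sub>R \<bar>1\<bar>)"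
    using lborel_has_bochner_integral_real_affine_iff[of 1 "\<lambda>u. exp (x * of_real u - of_real (exp u))" "Gamma x" "ln c"]
      has_bochner_integral_Gamma_exp[OF x] by simp
  then have "has_bochner_integral lborel (\<lambda>u. of_real c powr (- x) *
      exp (x * of_real (ln c + 1 * u) - of_real (exp (ln c + 1 * u)))) (of_real c powr (- x) * (Gamma x /\<^sub>R \<bar>1\<bar>))"
    by (rule has_bochner_integral_mult_right)
  moreover have "of_real c powr (- x) * exp (x * of_real (ln c + 1 * u) - of_real (exp (ln c + 1 * u))) =
      exp (x * of_real u - of_real (c * exp u))" for u
    using c by (simp add: powr_def Ln_of_real exp_add exp_add[symmetric] algebra_simps)
  ultimately show ?thesis by simp
qed

lemma has_bochner_integral_Gamma_exp_real:
  fixes x :: real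
  assumes x: "x > 0" and c: "c > 0"
  shows "has_bochner_integral lborel (\<lambda>u. exp (x * u - c * exp u)) (c powr (- x) * Gamma x)"
proof -
  have "has_bochner_integral lborel (\<lambda>u. exp (of_real x * of_real u - of_real (c * exp u)))
      (complex_of_real c powr (- of_real x) * Gamma (of_real x))"
    by (rule has_bochner_integral_Gamma_exp_scaled) (use x c in auto)
  then have "has_bochner_integral lborel (\<lambda>u. Re (exp (of_real x * of_real u - of_real (c * exp u))))
      (Re (complex_of_real c powr (- of_real x) * Gamma (of_real x)))"
    by (rule has_bochner_integral_bounded_linear[OF bounded_linear_Re])
  moreover have "exp (complex_of_real x * of_real u - of_real (c * exp u)) = of_real (exp (x * u - c * exp u))" for u
    by (simp only: of_real_mult[symmetric] of_real_diff[symmetric] exp_of_real)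
  moreover have "complex_of_real c powr (- of_real x) * Gamma (of_real x) = of_real (c powr (- x) * Gamma x)"
    using c by (simp add: Gamma_complex_of_real powr_of_real[symmetric])
  ultimately show ?thesis by (simp only: Re_complex_of_real)
qed

definition psi :: "real \<Rightarrow> real" where
  "psi u = disc_im (exp u) * exp (6 * u)"

lemma psi_pos: "psi u > 0"
  by (simp add: psi_def disc_im_pos)

lemma psi_minus: "psi (- u) = psi u"
proof -
  have "psi (- u) = disc_im (1 / exp u) * exp (- 6 * u)"
    by (simp add: psi_def exp_minus field_simps)
  also have "\<dots> = disc_im (exp u) * (exp u ^ 12 * exp (- 6 * u))"
    by (subst disc_im_inversion) simp_all
  also have "exp u ^ 12 * exp (- 6 * u) = exp (6 * u)"
    by (simp add: exp_of_nat_mult[symmetric] exp_add[symmetric])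
  finally show ?thesis by (simp add: psi_def)
qed

lemma continuous_psi: "continuous_on UNIV psi"
proof -
  have "continuous_on {0<..} disc_im"
    by (intro continuous_at_imp_continuous_on ballI DERIV_isCont[OF disc_im_deriv]) auto
  then have "continuous_on UNIV (\<lambda>u. disc_im (exp u))"
    by (rule continuous_on_compose2) (auto intro!: continuous_intros)
  then show ?thesis
    unfolding psi_def[abs_def] by (intro continuous_intros)
qed

lemma borel_measurable_psi [measurable]: "psi \<in> borel_measurable borel"
  by (rule borel_measurable_continuous_onI[OF continuous_psi])

lemma integrable_psi_exp_exp: "integrable lborel (\<lambda>u. psi u * exp (exp \<bar>u\<bar>))"
proof -
  obtain K where K: "K > 0" "\<And>q. norm q \<le> exp (- 2 * pi) \<Longrightarrow> norm (disc_q q) \<le> K * norm q"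
    using disc_q_bound[of "exp (- 2 * pi)"] by auto
  have bound: "psi u * exp (exp u) \<le> K * exp (6 * u - exp u)" if u: "u \<ge> 0" for u
  proof -
    have "disc_im (exp u) \<le> norm (complex_of_real (disc_im (exp u)))" by simp
    also have "\<dots> = norm (disc_q (of_real (exp (- 2 * pi * exp u))))"
      by (simp only: of_real_disc_im[OF exp_gt_zero])
    also have "\<dots> \<le> K * norm (complex_of_real (exp (- 2 * pi * exp u)))"
      using u by (intro K(2)) simp
    finally have "disc_im (exp u) \<le> K * exp (- 2 * pi * exp u)" by simp
    then have "psi u * exp (exp u) \<le> (K * exp (- 2 * pi * exp u)) * exp (6 * u) * exp (exp u)"
      unfolding psi_def by (intro mult_right_mono) auto
    also have "\<dots> = K * exp (6 * u - (2 * pi - 1) * exp u)"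
      by (simp add: exp_add[symmetric] exp_diff[symmetric] algebra_simps)
    also have "\<dots> \<le> K * exp (6 * u - 1 * exp u)"
    proof -
      have "1 * exp u \<le> (2 * pi - 1) * exp u"
        using pi_ge_two by (intro mult_right_mono) auto
      then show ?thesis using K(1) by (intro mult_left_mono) auto
    qed
    finally show ?thesis by simp
  qed
  have int: "integrable lborel (\<lambda>u::real. exp (6 * u - exp u))"
    using has_bochner_integral_Gamma_exp_real[of 6 1] by (auto simp: has_bochner_integral_iff)
  have int': "integrable lborel (\<lambda>u::real. exp (6 * (- u) - exp (- u)))"
    using lborel_integrable_real_affine[OF int, of "-1" 0] by simp
  have "integrable lborel (\<lambda>u. K * (exp (6 * u - exp u) + exp (6 * (- u) - exp (- u))))"
    by (intro integrable_mult_right Bochner_Integration.integrable_add int int')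
  then show ?thesis
  proof (rule Bochner_Integration.integrable_bound)
    show "AE u in lborel. norm (psi u * exp (exp \<bar>u\<bar>))
        \<le> norm (K * (exp (6 * u - exp u) + exp (6 * (- u) - exp (- u))))"
    proof (rule AE_I2)
      fix u
      have "psi u * exp (exp \<bar>u\<bar>) \<le> K * (exp (6 * u - exp u) + exp (6 * (- u) - exp (- u)))"
      proof (cases "u \<ge> 0")
        case True
        have "0 \<le> K * exp (6 * (- u) - exp (- u))" using K(1) by simp
        then show ?thesis using bound[OF True] True by (simp add: distrib_left)
      next
        case False
        have "0 \<le> K * exp (6 * u - exp u)" using K(1) by simp
        then show ?thesis using bound[of "- u"] False by (simp add: distrib_left psi_minus)
      qed
      then show "norm (psi u * exp (exp \<bar>u\<bar>))
        \<le> norm (K * (exp (6 * u - exp u) + exp (6 * (- u) - exp (- u))))"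
        using psi_pos[of u] K(1) by (simp add: abs_mult)
    qed
  qed measurable
qed

lemma linear_minus_exp_le:
  fixes r v :: real
  assumes r: "r \<ge> 0"
  shows "r * v - exp v \<le> 2 * r powr (3 / 2)"
proof (cases "r = 0")
  case False
  with r have r: "r > 0" by simp
  have "1 + (v - ln r) \<le> exp (v - ln r)" by (rule exp_ge_add_one_self)
  also have "\<dots> = exp v / r" using r by (simp add: exp_diff)
  finally have "r * v - exp v \<le> r * ln r - r"
    using r by (simp add: field_simps)
  also have "\<dots> \<le> r * (2 * sqrt r)"
  proof -
    have "ln r = 2 * ln (sqrt r)" using r by (simp add: ln_sqrt)
    also have "ln (sqrt r) \<le> sqrt r - 1" using r by (intro ln_le_minus_one) simp
    finally have "r * ln r \<le> r * (2 * sqrt r)" using r by (intro mult_left_mono) auto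
    then show ?thesis using r by linarith
  qed
  also have "\<dots> = 2 * r powr (3 / 2)"
    using r powr_add[of r 1 "1/2"] by (simp add: powr_half_sqrt)
  finally show ?thesis .
qed simp

lemma psi_exp_bound:
  assumes "r \<ge> 0"
  shows "psi u * exp (r * \<bar>u\<bar>) \<le> exp (2 * r powr (3 / 2)) * (psi u * exp (exp \<bar>u\<bar>))"
proof -
  have "exp (r * \<bar>u\<bar>) \<le> exp (2 * r powr (3 / 2) + exp \<bar>u\<bar>)"
    using linear_minus_exp_le[OF assms, of "\<bar>u\<bar>"] by simp
  then have "psi u * exp (r * \<bar>u\<bar>) \<le> psi u * exp (2 * r powr (3 / 2) + exp \<bar>u\<bar>)"
    using psi_pos[of u] by (intro mult_left_mono) auto
  then show ?thesis by (simp add: exp_add mult_ac)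
qed

lemma integrable_psi_exp:
  assumes "r \<ge> 0"
  shows "integrable lborel (\<lambda>u. psi u * exp (r * \<bar>u\<bar>))"
proof (rule Bochner_Integration.integrable_bound)
  show "integrable lborel (\<lambda>u. exp (2 * r powr (3 / 2)) * (psi u * exp (exp \<bar>u\<bar>)))"
    by (intro integrable_mult_right integrable_psi_exp_exp)
  show "AE u in lborel. norm (psi u * exp (r * \<bar>u\<bar>)) \<le> norm (exp (2 * r powr (3 / 2)) * (psi u * exp (exp \<bar>u\<bar>)))"
    using psi_exp_bound[OF assms] psi_pos by (intro AE_I2) (simp add: abs_mult less_imp_le)
qed measurable

lemma integral_psi_exp_le:
  assumes "r \<ge> 0"
  shows "(\<integral>u. psi u * exp (r * \<bar>u\<bar>) \<partial>lborel) \<le> (\<integral>u. psi u * exp (exp \<bar>u\<bar>) \<partial>lborel) * exp (2 * r powr (3 / 2))"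
proof -
  have "(\<integral>u. psi u * exp (r * \<bar>u\<bar>) \<partial>lborel) \<le> (\<integral>u. exp (2 * r powr (3 / 2)) * (psi u * exp (exp \<bar>u\<bar>)) \<partial>lborel)"
    by (intro integral_mono integrable_psi_exp assms integrable_mult_right integrable_psi_exp_exp psi_exp_bound)
  then show ?thesis by (simp add: mult.commute)
qed

definition Lambda_int :: "complex \<Rightarrow> complex" where
  "Lambda_int \<phi> = (\<integral>u. of_real (psi u) * cos (\<phi> * of_real u) \<partial>lborel)"

lemma norm_cos_le_exp: "norm (cos z) \<le> exp (norm z)" for z :: complex
proof -
  have "norm (exp (\<i> * z)) \<le> exp (norm z)" "norm (exp (- (\<i> * z))) \<le> exp (norm z)"
    using norm_exp[of "\<i> * z"] norm_exp[of "- (\<i> * z)"] by (simp_all only: norm_mult norm_minus_cancel norm_ii mult_1)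
  then show ?thesis
    unfolding cos_exp_eq norm_divide norm_numeral
    using norm_triangle_ineq[of "exp (\<i> * z)" "exp (- (\<i> * z))"] by linarith
qed

lemma cos_even_series:
  fixes z :: complex
  shows "(\<lambda>k. of_real ((-1) ^ k / fact (2 * k)) * z ^ (2 * k)) sums cos z"
proof -
  have "(\<lambda>n. cos_coeff n *\<^sub>R z ^ n) sums cos z" by (rule cos_converges)
  then have "(\<lambda>k. cos_coeff (2 * k) *\<^sub>R z ^ (2 * k)) sums cos z"
    by (subst sums_mono_reindex[of "\<lambda>k. 2 * k" "\<lambda>n. cos_coeff n *\<^sub>R z ^ n"])
      (auto simp: strict_mono_def cos_coeff_def elim!: evenE)
  then show ?thesis
    by (simp add: cos_coeff_def scaleR_conv_of_real)
qed

lemma even_exp_series_le: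
  fixes x :: real
  assumes "x \<ge> 0"
  shows "(\<Sum>k<N. x ^ (2 * k) / fact (2 * k)) \<le> exp x"
proof -
  have "(\<Sum>k<N. x ^ (2 * k) / fact (2 * k)) = (\<Sum>n\<in>(\<lambda>k. 2 * k) ` {..<N}. x ^ n /\<^sub>R fact n)"
    by (subst sum.reindex) (auto simp: inj_on_def field_simps)
  also have "\<dots> \<le> exp x"
    unfolding exp_def using assms by (intro sum_le_suminf summable_exp_generic) auto
  finally show ?thesis .
qed

lemma integrable_psi_cos: "integrable lborel (\<lambda>u. of_real (psi u) * cos (\<phi> * of_real u) :: complex)"
  and norm_psi_cos_le: "norm (of_real (psi u) * cos (\<phi> * of_real u) :: complex) \<le> psi u * exp (norm \<phi> * \<bar>u\<bar>)"
proof -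
  have bound: "norm (of_real (psi u) * cos (\<phi> * of_real u) :: complex) \<le> psi u * exp (norm \<phi> * \<bar>u\<bar>)" for u
    using psi_pos[of u] norm_cos_le_exp[of "\<phi> * of_real u"] by (simp add: norm_mult)
  show "norm (of_real (psi u) * cos (\<phi> * of_real u) :: complex) \<le> psi u * exp (norm \<phi> * \<bar>u\<bar>)"
    by (rule bound)
  have "(\<lambda>u. complex_of_real (psi u) * cos (\<phi> * of_real u)) \<in> borel_measurable lborel"
    unfolding measurable_lborel2
    by (intro borel_measurable_continuous_onI continuous_intros continuous_psi)
  then show "integrable lborel (\<lambda>u. of_real (psi u) * cos (\<phi> * of_real u) :: complex)"
    by (rule Bochner_Integration.integrable_bound[OF integrable_psi_exp[of "norm \<phi>"], rotated])
      (use bound psi_pos in \<open>auto intro!: AE_I2 simp: abs_mult less_imp_le\<close>)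
qed

lemma Lambda_int_growth:
  obtains A where "\<And>\<phi>. norm (Lambda_int \<phi>) \<le> A * exp (2 * norm \<phi> powr (3 / 2))"
proof
  fix \<phi> :: complex
  have "norm (Lambda_int \<phi>) \<le> (\<integral>u. norm (of_real (psi u) * cos (\<phi> * of_real u)) \<partial>lborel)"
    unfolding Lambda_int_def by (rule integral_norm_bound)
  also have "\<dots> \<le> (\<integral>u. psi u * exp (norm \<phi> * \<bar>u\<bar>) \<partial>lborel)"
    by (intro integral_mono integrable_norm integrable_psi_cos integrable_psi_exp norm_psi_cos_le norm_ge_zero)
  also have "\<dots> \<le> (\<integral>u. psi u * exp (exp \<bar>u\<bar>) \<partial>lborel) * exp (2 * norm \<phi> powr (3 / 2))"
    by (rule integral_psi_exp_le) simp
  finally show "norm (Lambda_int \<phi>) \<le> (\<integral>u. psi u * exp (exp \<bar>u\<bar>) \<partial>lborel) * exp (2 * norm \<phi> powr (3 / 2))" .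
qed

lemma Lambda_int_exp: "Lambda_int \<phi> = (\<integral>u. of_real (psi u) * exp (\<i> * \<phi> * of_real u) \<partial>lborel)"
proof -
  define f where "f = (\<lambda>u. of_real (psi u) * exp (\<i> * \<phi> * of_real u) :: complex)"
  have meas: "f \<in> borel_measurable lborel"
    unfolding measurable_lborel2 f_def
    by (intro borel_measurable_continuous_onI continuous_intros continuous_psi)
  have bound: "norm (f u) \<le> psi u * exp (norm \<phi> * \<bar>u\<bar>)" for u
    using psi_pos[of u] norm_exp[of "\<i> * \<phi> * of_real u"] by (simp add: f_def norm_mult)
  from meas have int: "integrable lborel f"
    by (rule Bochner_Integration.integrable_bound[OF integrable_psi_exp[of "norm \<phi>"], rotated])
      (use bound psi_pos in \<open>auto intro!: AE_I2 simp: abs_mult less_imp_le\<close>)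
  have int': "integrable lborel (\<lambda>u. f (- u))"
    using lborel_integrable_real_affine[OF int, of "-1" 0] by simp
  have eq: "(\<integral>u. f (- u) \<partial>lborel) = (\<integral>u. f u \<partial>lborel)"
    using lborel_integral_real_affine[of "-1" f 0] by simp
  have "Lambda_int \<phi> = (\<integral>u. (f u + f (- u)) / 2 \<partial>lborel)"
    unfolding Lambda_int_def
    by (intro Bochner_Integration.integral_cong refl)
      (simp add: f_def psi_minus cos_exp_eq distrib_left mult.assoc)
  also have "\<dots> = ((\<integral>u. f u \<partial>lborel) + (\<integral>u. f (- u) \<partial>lborel)) / 2"
    using int int' by simp
  also have "\<dots> = (\<integral>u. f u \<partial>lborel)"
    by (simp add: eq)
  finally show "Lambda_int \<phi> = (\<integral>u. of_real (psi u) * exp (\<i> * \<phi> * of_real u) \<partial>lborel)"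
    by (simp add: f_def)
qed

definition Lambda_coeff :: "nat \<Rightarrow> complex" where
  "Lambda_coeff k = of_real ((-1) ^ k / fact (2 * k) * (\<integral>u. psi u * u ^ (2 * k) \<partial>lborel))"

lemma Lambda_int_series: "(\<lambda>k. Lambda_coeff k * (\<phi>\<^sup>2) ^ k) sums Lambda_int \<phi>"
proof -
  define f where "f = (\<lambda>k u. of_real (psi u) * (of_real ((-1) ^ k / fact (2 * k)) * (\<phi> * of_real u) ^ (2 * k)) :: complex)"
  define r where "r = norm \<phi>"
  have r: "r \<ge> 0" by (simp add: r_def)
  have nf: "norm (f k u) = psi u * ((r * \<bar>u\<bar>) ^ (2 * k) / fact (2 * k))" for k u
    using psi_pos[of u] by (simp add: f_def r_def norm_mult norm_power norm_divide power_mult_distrib)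
  have partial: "(\<Sum>k<N. norm (f k u)) \<le> psi u * exp (r * \<bar>u\<bar>)" for N u
    unfolding nf sum_distrib_left[symmetric] using psi_pos[of u] r
    by (intro mult_left_mono even_exp_series_le) auto
  have meas: "f k \<in> borel_measurable lborel" for k
    unfolding measurable_lborel2 f_def
    by (intro borel_measurable_continuous_onI continuous_intros continuous_psi)
  have int: "integrable lborel (f k)" for k
  proof (rule Bochner_Integration.integrable_bound[OF integrable_psi_exp[OF r] meas], rule AE_I2)
    fix u
    have "norm (f k u) \<le> (\<Sum>k<Suc k. norm (f k u))"
      by (intro member_le_sum) auto
    also note partial
    finally show "norm (f k u) \<le> norm (psi u * exp (r * \<bar>u\<bar>))" by simp
  qed
  have sum_f: "(\<lambda>k. f k u) sums (of_real (psi u) * cos (\<phi> * of_real u))" for u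
    unfolding f_def by (intro sums_mult cos_even_series)
  have "(\<lambda>k. integral\<^sup>L lborel (f k)) sums (\<integral>u. (\<Sum>k. f k u) \<partial>lborel)"
  proof (rule sums_integral[OF int])
    show "AE u in lborel. summable (\<lambda>k. norm (f k u))"
      by (intro AE_I2 summableI_nonneg_bounded[OF _ partial]) auto
    show "summable (\<lambda>k. \<integral>u. norm (f k u) \<partial>lborel)"
    proof (rule summableI_nonneg_bounded)
      fix N
      have "(\<Sum>k<N. \<integral>u. norm (f k u) \<partial>lborel) = (\<integral>u. (\<Sum>k<N. norm (f k u)) \<partial>lborel)"
        using int by simp
      also have "\<dots> \<le> (\<integral>u. psi u * exp (r * \<bar>u\<bar>) \<partial>lborel)"
        using int r by (intro integral_mono partial integrable_psi_exp Bochner_Integration.integrable_sum integrable_norm)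
      finally show "(\<Sum>k<N. \<integral>u. norm (f k u) \<partial>lborel) \<le> (\<integral>u. psi u * exp (r * \<bar>u\<bar>) \<partial>lborel)" .
    qed simp
  qed
  moreover have "(\<integral>u. (\<Sum>k. f k u) \<partial>lborel) = Lambda_int \<phi>"
    unfolding Lambda_int_def using sum_f by (simp add: sums_iff)
  moreover have "integral\<^sup>L lborel (f k) = Lambda_coeff k * (\<phi>\<^sup>2) ^ k" for k
  proof -
    have "(\<phi> * of_real u) ^ (2 * k) = (\<phi>\<^sup>2) ^ k * of_real (u ^ (2 * k))" for u
      by (simp only: power_mult_distrib power_mult of_real_power)
    then have "f k = (\<lambda>u. (of_real ((-1) ^ k / fact (2 * k)) * (\<phi>\<^sup>2) ^ k) * of_real (psi u * u ^ (2 * k)))"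
      by (simp only: f_def of_real_mult mult_ac)
    then have "integral\<^sup>L lborel (f k) =
        (of_real ((-1) ^ k / fact (2 * k)) * (\<phi>\<^sup>2) ^ k) * of_real (\<integral>u. psi u * u ^ (2 * k) \<partial>lborel)"
      by (simp only: integral_mult_right_zero integral_complex_of_real)
    then show ?thesis by (simp add: Lambda_coeff_def)
  qed
  ultimately show ?thesis by simp
qed

definition Lambda_sqrt :: "complex \<Rightarrow> complex" where
  "Lambda_sqrt w = Lambda_int (csqrt w)"

lemma Lambda_sqrt_series: "(\<lambda>k. Lambda_coeff k * w ^ k) sums Lambda_sqrt w"
  using Lambda_int_series[of "csqrt w"] by (simp add: Lambda_sqrt_def)

lemma Lambda_sqrt_power2: "Lambda_sqrt (\<phi>\<^sup>2) = Lambda_int \<phi>"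
  using Lambda_sqrt_series[of "\<phi>\<^sup>2"] Lambda_int_series[of \<phi>] by (rule sums_unique2)

lemma holomorphic_Lambda_sqrt: "Lambda_sqrt holomorphic_on UNIV"
proof -
  have "Lambda_sqrt holomorphic_on ball 0 r" for r
    by (rule power_series_holomorphic[where a = Lambda_coeff]) (simp add: Lambda_sqrt_series)
  then have "Lambda_sqrt holomorphic_on (\<Union>r. ball 0 r)"
    by (intro holomorphic_on_UN_open) auto
  moreover have "(\<Union>r. ball 0 r) = (UNIV :: complex set)"
    by (auto intro: gt_ex)
  ultimately show ?thesis by simp
qed

lemma Lambda_sqrt_growth:
  obtains A where "\<And>w. norm (Lambda_sqrt w) \<le> A * exp (2 * norm w powr (3 / 4))"
proof -
  obtain A where A: "\<And>\<phi>. norm (Lambda_int \<phi>) \<le> A * exp (2 * norm \<phi> powr (3 / 2))"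
    by (rule Lambda_int_growth) blast
  have "norm (csqrt w) powr (3 / 2) = norm w powr (3 / 4)" for w
    by (simp add: powr_half_sqrt[symmetric] powr_powr)
  then show ?thesis
    using that[of A] A[of "csqrt _"] by (simp add: Lambda_sqrt_def)
qed

lemma Lambda_int_imaginary_nonzero: "Lambda_int (\<i> * of_real t) \<noteq> 0"
proof -
  define f where "f = (\<lambda>u. psi u * cosh (t * u))"
  have f_pos: "f u > 0" for u using psi_pos[of u] by (simp add: f_def cosh_real_pos)
  have eq: "of_real (psi u) * cos (\<i> * of_real t * of_real u) = complex_of_real (f u)" for u
    by (simp add: f_def of_real_cosh_complex cosh_conv_cos mult.assoc)
  have int: "integrable lborel f"
    using integrable_psi_cos[of "\<i> * of_real t"] unfolding eq
    by (rule complex_of_real_integrable_eq[THEN iffD1])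
  have "Lambda_int (\<i> * of_real t) = of_real (\<integral>u. f u \<partial>lborel)"
    unfolding Lambda_int_def eq by simp
  moreover have "(\<integral>u. f u \<partial>lborel) \<noteq> 0"
  proof
    assume "(\<integral>u. f u \<partial>lborel) = 0"
    then have "AE u in lborel. f u = 0"
      using integral_nonneg_eq_0_iff_AE[OF int] f_pos by (auto simp: less_imp_le)
    then have "AE u in lborel :: real measure. False"
      by eventually_elim (use f_pos in \<open>metis less_irrefl\<close>)
    then have "emeasure (lborel :: real measure) UNIV = 0"
      by (simp add: AE_iff_measurable[of UNIV])
    then show False by simp
  qed
  ultimately show ?thesis by simp
qed

section \<open>Analytic continuation and functional equation\<close>

definition xi_int :: "complex \<Rightarrow> complex" where
  "xi_int x = Lambda_sqrt (- (x - 6)\<^sup>2)"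

lemma holomorphic_xi_int: "xi_int holomorphic_on UNIV"
proof -
  have "(Lambda_sqrt \<circ> (\<lambda>x. - (x - 6)\<^sup>2)) holomorphic_on UNIV"
    by (intro holomorphic_on_compose_gen[OF _ holomorphic_Lambda_sqrt] holomorphic_intros) auto
  then show ?thesis by (simp add: xi_int_def[abs_def] o_def)
qed

lemma xi_int_critical_line: "xi_int (6 + \<i> * \<phi>) = Lambda_sqrt (\<phi>\<^sup>2)"
  by (simp add: xi_int_def power_mult_distrib)

lemma xi_int_mellin: "xi_int x = (\<integral>u. of_real (disc_im (exp u)) * exp (x * of_real u) \<partial>lborel)"
proof -
  define \<phi> where "\<phi> = - \<i> * (x - 6)"
  have "\<phi>\<^sup>2 = - (x - 6)\<^sup>2" by (simp add: \<phi>_def power_mult_distrib)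
  then have "xi_int x = Lambda_int \<phi>"
    unfolding xi_int_def by (metis Lambda_sqrt_power2)
  also have "\<dots> = (\<integral>u. of_real (psi u) * exp (\<i> * \<phi> * of_real u) \<partial>lborel)"
    by (rule Lambda_int_exp)
  also have "\<dots> = (\<integral>u. of_real (disc_im (exp u)) * exp (x * of_real u) \<partial>lborel)"
  proof (intro Bochner_Integration.integral_cong refl)
    fix u
    have "of_real (6 * u) + \<i> * \<phi> * of_real u = x * of_real u"
      by (simp add: \<phi>_def algebra_simps)
    then have "complex_of_real (exp (6 * u)) * exp (\<i> * \<phi> * of_real u) = exp (x * of_real u)"
      by (simp only: exp_of_real[symmetric] mult_exp_exp)
    then show "of_real (psi u) * exp (\<i> * \<phi> * of_real u) = of_real (disc_im (exp u)) * exp (x * of_real u)"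
      by (simp only: psi_def of_real_mult mult.assoc)
  qed
  finally show ?thesis .
qed

lemma xi_int_dirichlet:
  assumes x: "Re x > 13 / 2"
  shows "(\<lambda>l. of_int (ramanujan_tau (Suc l)) * of_nat (Suc l) powr (- x)) sums
    (xi_int x * of_real (2 * pi) powr x * rGamma x)"
proof -
  define \<sigma> where "\<sigma> = Re x"
  have \<sigma>: "\<sigma> > 0" "Re x > 0" using x by (auto simp: \<sigma>_def)
  define t where "t = (\<lambda>l. complex_of_int (ramanujan_tau (Suc l)))"
  define c where "c = (\<lambda>l. 2 * pi * real (Suc l))"
  have c: "c l > 0" for l by (simp add: c_def)
  define f where "f = (\<lambda>l u. t l * exp (x * of_real u - of_real (c l * exp u)))"
  have hf: "has_bochner_integral lborel (f l) (t l * (of_real (c l) powr (- x) * Gamma x))" for l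
    unfolding f_def by (intro has_bochner_integral_mult_right has_bochner_integral_Gamma_exp_scaled \<sigma> c)
  have nf: "norm (f l u) = \<bar>real_of_int (ramanujan_tau (Suc l))\<bar> * exp (\<sigma> * u - c l * exp u)" for l u
    by (simp add: f_def t_def norm_mult \<sigma>_def norm_exp_eq_Re)
  have hnf: "(\<integral>u. norm (f l u) \<partial>lborel) = \<bar>real_of_int (ramanujan_tau (Suc l))\<bar> * (c l powr (- \<sigma>) * Gamma \<sigma>)" for l
    unfolding nf using has_bochner_integral_Gamma_exp_real[OF \<sigma>(1) c[of l]]
    by (simp add: has_bochner_integral_iff)
  define q where "q = (\<lambda>u. exp (- 2 * pi * exp u))"
  have q: "0 \<le> q u" "q u < 1" for u by (simp_all add: q_def)
  have pow: "exp (- c l * exp u) = q u ^ Suc l" for l u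
  proof -
    have "- c l * exp u = real (Suc l) * (- 2 * pi * exp u)" by (simp add: c_def algebra_simps)
    then show ?thesis by (simp only: q_def exp_of_nat_mult)
  qed
  have fq: "f l u = exp (x * of_real u) * (t l * of_real (q u) ^ Suc l)" for l u
  proof -
    have "exp (x * of_real u - of_real (c l * exp u)) = exp (x * of_real u) * exp (of_real (- c l * exp u))"
      by (simp add: mult_exp_exp)
    also have "exp (of_real (- c l * exp u)) = complex_of_real (q u) ^ Suc l"
      unfolding exp_of_real pow by simp
    finally show ?thesis by (simp add: f_def)
  qed
  have sums_f: "(\<lambda>l. f l u) sums (exp (x * of_real u) * of_real (disc_im (exp u)))" for u
  proof -
    have "(\<lambda>n. of_int (ramanujan_tau n) * complex_of_real (q u) ^ n) sums disc_q (of_real (q u))"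
      using q[of u] by (intro ramanujan_tau_sums) simp
    then have "(\<lambda>n. of_int (ramanujan_tau n) * complex_of_real (q u) ^ n) sums of_real (disc_im (exp u))"
      by (simp only: q_def of_real_disc_im[OF exp_gt_zero])
    then have "(\<lambda>l. t l * complex_of_real (q u) ^ Suc l) sums of_real (disc_im (exp u))"
      unfolding t_def by (subst sums_Suc_iff[where f = "\<lambda>n. of_int (ramanujan_tau n) * complex_of_real (q u) ^ n"]) simp
    then show ?thesis
      unfolding fq by (rule sums_mult)
  qed
  have sums: "(\<lambda>l. integral\<^sup>L lborel (f l)) sums (\<integral>u. (\<Sum>l. f l u) \<partial>lborel)"
  proof (rule sums_integral)
    show "integrable lborel (f l)" for l using hf[of l] by (simp add: has_bochner_integral_iff)
    show "AE u in lborel. summable (\<lambda>l. norm (f l u))"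
    proof (rule AE_I2)
      fix u
      have "summable (\<lambda>n. norm (complex_of_int (ramanujan_tau n)) * q u ^ n)"
        by (rule ramanujan_tau_summable[OF q])
      then have "summable (\<lambda>l. norm (t l) * q u ^ Suc l)"
        unfolding t_def by (subst summable_Suc_iff[where f = "\<lambda>n. norm (complex_of_int (ramanujan_tau n)) * q u ^ n"])
      then have "summable (\<lambda>l. norm (exp (x * of_real u)) * (norm (t l) * q u ^ Suc l))"
        by (rule summable_mult)
      then show "summable (\<lambda>l. norm (f l u))"
        unfolding fq norm_mult norm_power using q[of u] by (simp del: power_Suc)
    qed
    have "summable (\<lambda>l. (2 * pi) powr (- \<sigma>) * Gamma \<sigma> * (\<bar>real_of_int (ramanujan_tau (Suc l))\<bar> * real (Suc l) powr (- \<sigma>)))"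
      using x by (intro summable_mult ramanujan_tau_dirichlet_summable) (simp add: \<sigma>_def)
    moreover have "(2 * pi) powr (- \<sigma>) * Gamma \<sigma> * (\<bar>real_of_int (ramanujan_tau (Suc l))\<bar> * real (Suc l) powr (- \<sigma>)) =
        (\<integral>u. norm (f l u) \<partial>lborel)" for l
    proof -
      have "c l powr (- \<sigma>) = (2 * pi) powr (- \<sigma>) * real (Suc l) powr (- \<sigma>)"
        unfolding c_def by (rule powr_mult)
      then show ?thesis by (simp only: hnf mult_ac)
    qed
    ultimately show "summable (\<lambda>l. \<integral>u. norm (f l u) \<partial>lborel)" by (simp only:)
  qed
  have "(\<integral>u. (\<Sum>l. f l u) \<partial>lborel) = xi_int x"
    unfolding xi_int_mellin using sums_f by (simp add: sums_iff mult.commute)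
  with sums have "(\<lambda>l. t l * (of_real (c l) powr (- x) * Gamma x)) sums xi_int x"
    using has_bochner_integral_integral_eq[OF hf] by simp
  then have "(\<lambda>l. (t l * (of_real (c l) powr (- x) * Gamma x)) * (of_real (2 * pi) powr x * rGamma x)) sums
      (xi_int x * (of_real (2 * pi) powr x * rGamma x))"
    by (rule sums_mult2)
  moreover have "(t l * (of_real (c l) powr (- x) * Gamma x)) * (of_real (2 * pi) powr x * rGamma x) =
      t l * of_nat (Suc l) powr (- x)" for l
  proof -
    have "x \<notin> \<int>\<^sub>\<le>\<^sub>0" using \<sigma> by (auto elim!: nonpos_Ints_cases)
    then have "Gamma x * rGamma x = 1"
      by (simp add: rGamma_inverse_Gamma Gamma_eq_zero_iff)
    moreover have "complex_of_real (c l) powr (- x) = of_real (2 * pi) powr (- x) * of_nat (Suc l) powr (- x)"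
      unfolding c_def of_real_mult[of "2 * pi"] by (subst powr_times_real) auto
    moreover have "complex_of_real (2 * pi) powr (- x) * of_real (2 * pi) powr x = 1"
      by (simp add: powr_minus)
    moreover have "t * (p * N * G) * (P * R) = t * N * ((p * P) * (G * R))" for t p N G P R :: complex
      by (simp only: mult_ac)
    ultimately show ?thesis by (simp only: mult_1_right)
  qed
  ultimately show ?thesis
    by (simp only: t_def mult.assoc)
qed

lemma ramanujan_zeta_eq: "ramanujan_zeta x = xi_int x * of_real (2 * pi) powr x * rGamma x"
proof -
  define g where "g = (\<lambda>x. xi_int x * complex_of_real (2 * pi) powr x * rGamma x)"
  define U where "U = {x :: complex. Re x > 13 / 2}"
  have U: "open U" "7 \<in> U"
    unfolding U_def by (simp_all add: open_halfspace_Re_gt del: less_divide_eq_numeral1 divide_less_eq_numeral1)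
  have g: "g holomorphic_on UNIV"
    unfolding g_def by (intro holomorphic_intros holomorphic_xi_int)
  have "entire_continuation (\<lambda>x. \<Sum>l. of_int (ramanujan_tau (Suc l)) * of_nat (Suc l) powr (- x)) U = g"
    unfolding entire_continuation_def
  proof (rule the_equality)
    show "g holomorphic_on UNIV \<and> (\<forall>z\<in>U. g z = (\<Sum>l. of_int (ramanujan_tau (Suc l)) * of_nat (Suc l) powr (- z)))"
      using g xi_int_dirichlet by (auto simp: U_def g_def sums_iff)
    fix h assume h: "h holomorphic_on UNIV \<and> (\<forall>z\<in>U. h z = (\<Sum>l. of_int (ramanujan_tau (Suc l)) * of_nat (Suc l) powr (- z)))"
    have eq: "h z = g z" if "z \<in> U" for z
      using h that xi_int_dirichlet[of z] by (auto simp: U_def g_def sums_iff)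
    show "h = g"
    proof
      fix z
      show "h z = g z"
        by (rule analytic_continuation_open[of U UNIV h g]) (use U h g eq in auto)
    qed
  qed
  then show ?thesis by (simp add: ramanujan_zeta_def U_def g_def)
qed

lemma ramanujan_xi_eq: "ramanujan_xi x = xi_int x"
  unfolding ramanujan_xi_def
proof (rule remove_sings_eqI)
  have "open (- (\<int>\<^sub>\<le>\<^sub>0 - {x}))"
    by (intro open_Compl closed_subset_Ints) (auto dest: nonpos_Ints_Int)
  then have "\<forall>\<^sub>F w in nhds x. w \<in> - (\<int>\<^sub>\<le>\<^sub>0 - {x})"
    by (rule eventually_nhds_in_open) auto
  then have "\<forall>\<^sub>F w in at x. w \<notin> \<int>\<^sub>\<le>\<^sub>0"
    unfolding eventually_at_filter by eventually_elim auto
  then have "\<forall>\<^sub>F w in at x. xi_int w = of_real (2 * pi) powr (- w) * Gamma w * ramanujan_zeta w"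
  proof eventually_elim
    case (elim w)
    have "Gamma w * rGamma w = 1"
      using elim by (simp add: rGamma_inverse_Gamma Gamma_eq_zero_iff)
    moreover have "complex_of_real (2 * pi) powr (- w) * of_real (2 * pi) powr w = 1"
      by (simp add: powr_minus)
    moreover have "p * G * (X * P * R) = X * (p * P) * (G * R)" for p G X P R :: complex
      by (simp only: mult_ac)
    ultimately show ?case by (simp only: ramanujan_zeta_eq mult_1_right)
  qed
  moreover have "xi_int \<midarrow>x\<rightarrow> xi_int x"
    using holomorphic_on_imp_continuous_on[OF holomorphic_xi_int]
    by (simp add: continuous_on_eq_continuous_at isCont_def)
  ultimately show "(\<lambda>x. of_real (2 * pi) powr (- x) * Gamma x * ramanujan_zeta x) \<midarrow>x\<rightarrow> xi_int x"
    using tendsto_cong by fast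
qed

lemma ramanujan_Lambda_eq: "ramanujan_Lambda \<phi> = Lambda_sqrt (\<phi>\<^sup>2)"
  by (simp add: ramanujan_Lambda_def ramanujan_xi_eq xi_int_critical_line)

section \<open>The product expansion\<close>

lemma genus_zero_Lambda_sqrt: "\<exists>A. genus_zero Lambda_sqrt A 2 (3 / 4)"
proof -
  obtain A where A: "\<And>w. norm (Lambda_sqrt w) \<le> A * exp (2 * norm w powr (3 / 4))"
    by (rule Lambda_sqrt_growth) blast
  have "Lambda_sqrt 0 \<noteq> 0"
    using Lambda_int_imaginary_nonzero[of 0] by (simp add: Lambda_sqrt_def)
  then have "genus_zero Lambda_sqrt A 2 (3 / 4)"
    by unfold_locales (use A holomorphic_Lambda_sqrt in auto)
  then show ?thesis by blast
qed

lemma zorder_comp_power2: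
  assumes g: "g holomorphic_on UNIV" "g b \<noteq> 0" and z: "z \<noteq> 0"
  shows "zorder (\<lambda>\<phi>. g (\<phi>\<^sup>2)) z = zorder g (z\<^sup>2)"
proof -
  obtain h n where h: "h holomorphic_on UNIV" "h (z\<^sup>2) \<noteq> 0" "\<And>w. g w = h w * (w - z\<^sup>2) ^ n"
    by (rule entire_factor_zero[OF g, of "z\<^sup>2"]) blast
  have "zorder g (z\<^sup>2) = int n"
    by (rule zorder_eqI[of UNIV _ h]) (use h in auto)
  moreover have "zorder (\<lambda>\<phi>. g (\<phi>\<^sup>2)) z = int n"
  proof (rule zorder_eqI[of UNIV])
    have "(h \<circ> (\<lambda>\<phi>. \<phi>\<^sup>2)) holomorphic_on UNIV"
      by (intro holomorphic_on_compose_gen[OF _ h(1)] holomorphic_intros) auto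
    then show "(\<lambda>\<phi>. h (\<phi>\<^sup>2) * (\<phi> + z) ^ n) holomorphic_on UNIV"
      by (intro holomorphic_intros) (simp add: o_def)
    show "h (z\<^sup>2) * (z + z) ^ n \<noteq> 0" using h(2) z by simp
    show "g (w\<^sup>2) = h (w\<^sup>2) * (w + z) ^ n * (w - z) powi int n" for w
    proof -
      have "w\<^sup>2 - z\<^sup>2 = (w + z) * (w - z)" by (simp add: power2_eq_square algebra_simps)
      then show ?thesis by (simp add: h(3) power_mult_distrib)
    qed
  qed auto
  ultimately show ?thesis by simp
qed

theorem corollary5:
  fixes \<phi> :: complex
  shows "convergent_prod_on (\<lambda>(z, k). 1 - \<phi>\<^sup>2 / z\<^sup>2) (zeros_right_with_mult ramanujan_Lambda) \<and>
         ramanujan_Lambda \<phi> =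
           ramanujan_Lambda 0 *
             infprod_on (\<lambda>(z, k). 1 - \<phi>\<^sup>2 / z\<^sup>2) (zeros_right_with_mult ramanujan_Lambda)"
proof -
  obtain A where "genus_zero Lambda_sqrt A 2 (3 / 4)" using genus_zero_Lambda_sqrt by blast
  then interpret genus_zero Lambda_sqrt A 2 "3 / 4" .
  have Lam: "ramanujan_Lambda = (\<lambda>\<phi>. Lambda_sqrt (\<phi>\<^sup>2))"
    by (simp add: fun_eq_iff ramanujan_Lambda_eq)
  define sq where "sq = (\<lambda>p::complex \<times> nat. ((fst p)\<^sup>2, snd p))"
  have mem: "(z, k) \<in> zeros_right_with_mult ramanujan_Lambda \<longleftrightarrow> Re z > 0 \<and> (z\<^sup>2, k) \<in> zero_index" for z k
  proof (cases "z = 0")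
    case False
    then show ?thesis
      using zorder_comp_power2[OF hol g0 False] by (auto simp: zeros_right_with_mult_def zero_index_def Lam)
  qed (auto simp: zeros_right_with_mult_def)
  have bij: "bij_betw sq (zeros_right_with_mult ramanujan_Lambda) zero_index"
  proof (rule bij_betw_byWitness[where f' = "\<lambda>p. (csqrt (fst p), snd p)"])
    show "\<forall>p\<in>zeros_right_with_mult ramanujan_Lambda. (csqrt (fst (sq p)), snd (sq p)) = p"
      by (auto simp: sq_def mem csqrt_square)
    show "\<forall>p\<in>zero_index. sq (csqrt (fst p), snd p) = p"
      by (auto simp: sq_def)
    show "sq ` zeros_right_with_mult ramanujan_Lambda \<subseteq> zero_index"
      by (auto simp: sq_def mem)
    show "(\<lambda>p. (csqrt (fst p), snd p)) ` zero_index \<subseteq> zeros_right_with_mult ramanujan_Lambda"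
    proof safe
      fix w k assume p: "(w, k) \<in> zero_index"
      have "Re (csqrt w) \<noteq> 0"
      proof
        assume "Re (csqrt w) = 0"
        then have "csqrt w = \<i> * of_real (Im (csqrt w))" by (simp add: complex_eq_iff)
        then have "Lambda_sqrt w \<noteq> 0"
          unfolding Lambda_sqrt_def by (metis Lambda_int_imaginary_nonzero)
        then show False using p by (simp add: zero_index_def)
      qed
      moreover have "Re (csqrt w) \<ge> 0" using csqrt_principal[of w] by auto
      ultimately show "(csqrt (fst (w, k)), snd (w, k)) \<in> zeros_right_with_mult ramanujan_Lambda"
        using p by (simp add: mem)
    qed
  qed
  have "has_prod_on ((\<lambda>(z, k). 1 - \<phi>\<^sup>2 / z) \<circ> sq) (Lambda_sqrt (\<phi>\<^sup>2) / Lambda_sqrt 0) (zeros_right_with_mult ramanujan_Lambda)"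
    by (rule has_prod_on_reindex[OF bij has_prod_on_zeros])
  moreover have "(\<lambda>(z, k). 1 - \<phi>\<^sup>2 / z) \<circ> sq = (\<lambda>(z, k). 1 - \<phi>\<^sup>2 / z\<^sup>2)"
    by (auto simp: sq_def fun_eq_iff)
  ultimately have "has_prod_on (\<lambda>(z, k). 1 - \<phi>\<^sup>2 / z\<^sup>2) (ramanujan_Lambda \<phi> / ramanujan_Lambda 0)
      (zeros_right_with_mult ramanujan_Lambda)"
    by (simp add: Lam)
  moreover have "ramanujan_Lambda 0 \<noteq> 0" using g0 by (simp add: Lam)
  ultimately show ?thesis
    by (auto simp: convergent_prod_on_def infprod_on_eqI)
qed

end
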